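(* Let $\mathcal{M}$ be a von Neumann algebra and let $\preceq$ be the star order on $\mathcal{M}$. Then the following statements hold: (i) The poset $(\mathcal{M},\preceq)$ is Dedekind complete. (ii) The supremum of every subset of $P(\mathcal{M})$ in $(\mathcal{M},\preceq)$ is a projection. The infimum of every nonempty subset of $P(\mathcal{M})$ in $(\mathcal{M},\preceq)$ is a projection. (In particular, these suprema and infima exist.) (iii) The supremum of every bounded set $S\subseteq \mathcal{M}_{sa}$ in $(\mathcal{M},\preceq)$ is a self-adjoint element. The infimum of every nonempty set $S\subseteq \mathcal{M}_{sa}$ in $(\mathcal{M},\preceq)$ is a self-adjoint element. (In particular, these suprema and infima exist.) (iv) The supremum of every bounded set $S\subseteq \mathcal{M}_+$ in $(\mathcal{M},\preceq)$ is a positive element. The infimum of every nonempty set $S\subseteq \mathcal{M}_+$ in $(\mathcal{M},\preceq)$ is a positive element. (In particular, these suprema and infima exist.)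
   Context: A von Neumann algebra is a strongly closed C*-subalgebra of the C*-algebra $\mathscr{B}(\mathscr{H})$ of all bounded operators on a complex Hilbert space $\mathscr{H}$. The star order on a von Neumann algebra $\mathcal{M}$ is the partial order defined by $x\preceq y$ if and only if $x^*x=x^*y$ and $xx^*=yx^*$. $P(\mathcal{M})$, $\mathcal{M}_{sa}$ and $\mathcal{M}_+$ denote the sets of all projections, all self-adjoint elements and all positive elements (in the usual operator sense) of $\mathcal{M}$, respectively. A poset is Dedekind complete if every nonempty subset that is bounded above has a supremum. "Bounded" means order bounded in $(\mathcal{M},\preceq)$, i.e. having an upper and a lower bound in $\mathcal{M}$ with respect to $\preceq$ (since $0\preceq x$ for all $x$, this amounts to being bounded above). The empty set is allowed in the statements about suprema; its supremum is $0$. *)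

theory Defs
  imports "HOL-Analysis.Analysis" "HOL-Algebra.Order"
begin

section \<open>Complex Hilbert spaces\<close>

text \<open>
  The underlying real Banach space structure is inherited from \<^class>\<open>banach\<close>; the inner
  product is conjugate linear in its first and linear in its second argument.
\<close>

class complex_hilbert_space = banach +
  fixes scaleC :: "complex \<Rightarrow> 'a \<Rightarrow> 'a"  (infixr "*\<^sub>C" 75)
    and cinner :: "'a \<Rightarrow> 'a \<Rightarrow> complex"
  assumes scaleC_add_right: "a *\<^sub>C (x + y) = a *\<^sub>C x + a *\<^sub>C y"
    and scaleC_add_left: "(a + b) *\<^sub>C x = a *\<^sub>C x + b *\<^sub>C x"
    and scaleC_scaleC: "a *\<^sub>C (b *\<^sub>C x) = (a * b) *\<^sub>C x"
    and scaleC_of_real: "complex_of_real r *\<^sub>C x = r *\<^sub>R x"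
    and cinner_commute: "cinner x y = cnj (cinner y x)"
    and cinner_add_right: "cinner x (y + z) = cinner x y + cinner x z"
    and cinner_scaleC_right: "cinner x (a *\<^sub>C y) = a * cinner x y"
    and cinner_self: "cinner x x = complex_of_real ((norm x)\<^sup>2)"

instantiation complex :: complex_hilbert_space
begin

definition scaleC_complex :: "complex \<Rightarrow> complex \<Rightarrow> complex"
  where "scaleC_complex a x = a * x"

definition cinner_complex :: "complex \<Rightarrow> complex \<Rightarrow> complex"
  where "cinner_complex x y = cnj x * y"

instance
  by standard
    (simp_all add: scaleC_complex_def cinner_complex_def algebra_simps scaleR_conv_of_real
      complex_norm_square flip: of_real_power)

end

lemma norm_scaleC:
  fixes x :: "'a::complex_hilbert_space"
  shows "norm (a *\<^sub>C x) = cmod a * norm x"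
proof -
  have "complex_of_real ((norm (a *\<^sub>C x))\<^sup>2) = cinner (a *\<^sub>C x) (a *\<^sub>C x)"
    by (simp add: cinner_self)
  also have "\<dots> = a * cnj (a * cinner x x)"
    by (metis cinner_commute cinner_scaleC_right)
  also have "\<dots> = complex_of_real ((cmod a * norm x)\<^sup>2)"
    by (simp add: cinner_self power_mult_distrib complex_norm_square[symmetric] mult.assoc[symmetric]
        del: of_real_power of_real_mult) (simp add: complex_norm_square)
  finally have "(norm (a *\<^sub>C x))\<^sup>2 = (cmod a * norm x)\<^sup>2"
    using of_real_eq_iff by blast
  then show ?thesis
    by simp
qed

lemma bounded_linear_scaleC:
  "bounded_linear (\<lambda>x::'a::complex_hilbert_space. a *\<^sub>C x)"
proof (rule bounded_linear_intro[where K = "cmod a"])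
  fix r :: real and x :: 'a
  show "a *\<^sub>C (r *\<^sub>R x) = r *\<^sub>R (a *\<^sub>C x)"
    by (simp add: scaleC_of_real[symmetric] scaleC_scaleC mult.commute)
qed (simp_all add: scaleC_add_right norm_scaleC mult.commute)

section \<open>Bounded operators and their adjoints\<close>

text \<open>
  The type of bounded linear functions is that of real linear ones, so complex linearity is
  imposed separately.
\<close>

definition bounded_operators :: "('a::complex_hilbert_space \<Rightarrow>\<^sub>L 'a) set"
  where "bounded_operators = {x. \<forall>c v. blinfun_apply x (c *\<^sub>C v) = c *\<^sub>C blinfun_apply x v}"

lift_definition scaleC_blinfun ::
  "complex \<Rightarrow> ('a::complex_hilbert_space \<Rightarrow>\<^sub>L 'a) \<Rightarrow> ('a \<Rightarrow>\<^sub>L 'a)"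
  is "\<lambda>c x v. c *\<^sub>C x v"
  by (rule bounded_linear_compose[OF bounded_linear_scaleC])

definition adj :: "('a::complex_hilbert_space \<Rightarrow>\<^sub>L 'a) \<Rightarrow> ('a \<Rightarrow>\<^sub>L 'a)"
  where "adj x =
    (THE y. \<forall>v w. cinner (blinfun_apply x v) w = cinner v (blinfun_apply y w))"

section \<open>Von Neumann algebras\<close>

definition cstar_subalgebra :: "('a::complex_hilbert_space \<Rightarrow>\<^sub>L 'a) set \<Rightarrow> bool"
  where "cstar_subalgebra M \<longleftrightarrow>
    M \<subseteq> bounded_operators \<and>
    0 \<in> M \<and>
    (\<forall>x\<in>M. \<forall>y\<in>M. x + y \<in> M) \<and>
    (\<forall>c. \<forall>x\<in>M. scaleC_blinfun c x \<in> M) \<and>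
    (\<forall>x\<in>M. \<forall>y\<in>M. x o\<^sub>L y \<in> M) \<and>
    (\<forall>x\<in>M. adj x \<in> M) \<and>
    closed M"

text \<open>No unit is required: in particular the identity operator need not belong to the algebra.\<close>

definition von_neumann_algebra :: "('a::complex_hilbert_space \<Rightarrow>\<^sub>L 'a) set \<Rightarrow> bool"
  where "von_neumann_algebra M \<longleftrightarrow>
    cstar_subalgebra M \<and> closedin strong_operator_topology M"

definition projections ::
  "('a::complex_hilbert_space \<Rightarrow>\<^sub>L 'a) set \<Rightarrow> ('a \<Rightarrow>\<^sub>L 'a) set"
  where "projections M = {x \<in> M. adj x = x \<and> x o\<^sub>L x = x}"

definition self_adjoints ::
  "('a::complex_hilbert_space \<Rightarrow>\<^sub>L 'a) set \<Rightarrow> ('a \<Rightarrow>\<^sub>L 'a) set"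
  where "self_adjoints M = {x \<in> M. adj x = x}"

definition positives ::
  "('a::complex_hilbert_space \<Rightarrow>\<^sub>L 'a) set \<Rightarrow> ('a \<Rightarrow>\<^sub>L 'a) set"
  where "positives M = {x \<in> M. \<forall>v. cinner v (blinfun_apply x v) \<in> \<real>\<^sub>\<ge>\<^sub>0}"

section \<open>The star order\<close>

definition star_le ::
  "('a::complex_hilbert_space \<Rightarrow>\<^sub>L 'a) \<Rightarrow> ('a \<Rightarrow>\<^sub>L 'a) \<Rightarrow> bool"
  where "star_le x y \<longleftrightarrow>
    adj x o\<^sub>L x = adj x o\<^sub>L y \<and> x o\<^sub>L adj x = y o\<^sub>L adj x"

definition star_poset ::
  "('a::complex_hilbert_space \<Rightarrow>\<^sub>L 'a) set \<Rightarrow> ('a \<Rightarrow>\<^sub>L 'a) gorder"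
  where "star_poset M = \<lparr>carrier = M, eq = (=), le = star_le\<rparr>"

section \<open>Order-theoretic notions\<close>

definition dedekind_complete :: "'a gorder \<Rightarrow> bool"
  where "dedekind_complete L \<longleftrightarrow>
    partial_order L \<and>
    (\<forall>S. S \<subseteq> carrier L \<and> S \<noteq> {} \<and> Upper L S \<noteq> {} \<longrightarrow> (\<exists>s. is_lub L s S))"

definition order_bounded :: "'a gorder \<Rightarrow> 'a set \<Rightarrow> bool"
  where "order_bounded L S \<longleftrightarrow> Upper L S \<noteq> {} \<and> Lower L S \<noteq> {}"

definition sup_exists_in :: "'a gorder \<Rightarrow> 'a set \<Rightarrow> 'a set \<Rightarrow> bool"
  where "sup_exists_in L S T \<longleftrightarrow>
    (\<exists>s. is_lub L s S) \<and> (\<forall>s. is_lub L s S \<longrightarrow> s \<in> T)"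

definition inf_exists_in :: "'a gorder \<Rightarrow> 'a set \<Rightarrow> 'a set \<Rightarrow> bool"
  where "inf_exists_in L S T \<longleftrightarrow>
    (\<exists>s. is_glb L s S) \<and> (\<forall>s. is_glb L s S \<longrightarrow> s \<in> T)"

end

theory Submission
  imports Defs
begin

text \<open>
  For bounded operators \<open>x \<preceq> y\<close> means that \<open>y\<close> agrees with \<open>x\<close> on the range of \<open>x*\<close> and
  that \<open>y*\<close> agrees with \<open>x*\<close> on the range of \<open>x\<close>.  As \<open>x\<close> vanishes on the orthogonal
  complement of the range of \<open>x*\<close>, everything below a fixed \<open>b\<close> is determined by its support: \<open>x\<close>
  is \<open>b\<close> times the projection onto the closed range of \<open>x*\<close>.

  \<^bold>\<open>Suprema.\<close>  Let \<open>S\<close> be bounded above by \<open>b\<close> and let \<open>P\<close> be the projection whose kernel is the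
  common kernel of the elements of \<open>S\<close>; its range is the closed span of the ranges of the \<open>x*\<close>.
  Then \<open>bP\<close> is the supremum of \<open>S\<close>: any two upper bounds agree with all \<open>x\<close> in \<open>S\<close> on the
  ranges of the \<open>x*\<close>, hence with each other on the range of \<open>P\<close> (\<open>is_lub_compose_support\<close>).  The
  point where the strong closedness of the algebra enters is that \<open>P\<close> belongs to it
  (\<open>support_projection_exists\<close>).  For finite \<open>F \<subseteq> S\<close> let \<open>T\<close> be the sum of \<open>x*x\<close> over \<open>F\<close>; for
  small \<open>c > 0\<close> the polynomials \<open>1 - (1 - cT)^n\<close> in \<open>T\<close> have no constant term, so they belong
  to the algebra even if it has no unit, and they converge strongly to the projection whose
  kernel is that of \<open>T\<close> (\<open>richardson_tendsto_0\<close>).  Enlarging \<open>F\<close> approximates \<open>P\<close>.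

  \<^bold>\<open>Infima.\<close>  The infimum of a nonempty set is the supremum of its lower bounds, which are
  bounded above by any element of the set.

  \<^bold>\<open>Projections.\<close>  A set of projections is bounded above by its own \<open>P\<close>, so \<open>PP = P\<close> is its
  supremum.  Every operator below a projection is a projection, which settles infima.

  \<^bold>\<open>Self-adjoint elements.\<close>  The adjoint is an order automorphism fixing every element of the
  set, so it fixes the supremum and the infimum.

  \<^bold>\<open>Positive elements.\<close>  An infimum \<open>s\<close> agrees on its range with a positive operator and vanishes
  on the complement of its range.  A supremum \<open>s\<close> agrees with \<open>x\<close> on the range of each \<open>x\<close> in
  the set and hence is positive on each of these \<open>s\<close>-invariant subspaces; the difficulty is to
  pass to their sum without functional calculus.  Consider the vectors \<open>w\<close> with bounded orbit
  \<open>(1 - cs)^n w\<close>.  They form a subspace, which contains all these ranges because \<open>1 - cs\<close> is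
  contractive on them.  On a bounded orbit of a self-adjoint operator the norms are a bounded
  log-convex sequence, so they decrease, and the first step of this decrease says that
  \<open>\<langle>w, s w\<rangle>\<close> is nonnegative (\<open>bounded_richardson_orbit_imp_nonneg\<close>).
\<close>

section \<open>Inner products\<close>

lemma cinner_add_left: "cinner (x + y) z = cinner x z + cinner y z"
  by (metis cinner_add_right cinner_commute complex_cnj_add)

lemma cinner_scaleC_left: "cinner (a *\<^sub>C x) y = cnj a * cinner x y"
  by (metis cinner_commute cinner_scaleC_right complex_cnj_mult)

lemma cinner_scaleR_right: "cinner x (r *\<^sub>R y) = of_real r * cinner x y"
  by (metis cinner_scaleC_right scaleC_of_real)

lemma cinner_scaleR_left: "cinner (r *\<^sub>R x) y = of_real r * cinner x y"
  by (metis cinner_scaleC_left complex_cnj_complex_of_real scaleC_of_real)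

lemma cinner_zero_right [simp]: "cinner x 0 = 0"
  using cinner_scaleR_right[of x 0 0] by simp

lemma cinner_zero_left [simp]: "cinner 0 x = 0"
  using cinner_scaleR_left[of 0 0 x] by simp

lemma cinner_diff_right: "cinner x (y - z) = cinner x y - cinner x z"
  using cinner_add_right[of x y "(- 1) *\<^sub>R z"] cinner_scaleR_right[of x "- 1" z] by simp

lemma cinner_diff_left: "cinner (x - y) z = cinner x z - cinner y z"
  using cinner_add_left[of x "(- 1) *\<^sub>R y" z] cinner_scaleR_left[of "- 1" y z] by simp

lemma cinner_sum_right: "cinner x (\<Sum>i\<in>A. f i) = (\<Sum>i\<in>A. cinner x (f i))"
  by (induction A rule: infinite_finite_induct) (auto simp: cinner_add_right)

lemma scaleC_minus_one: "(- 1) *\<^sub>C x = - x"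
  using scaleC_of_real[of "- 1" x] by simp

lemma scaleC_diff_right: "a *\<^sub>C (x - y) = a *\<^sub>C x - a *\<^sub>C y"
  using bounded_linear.linear[OF bounded_linear_scaleC, of a] by (rule linear_diff)

lemma scaleC_zero_right [simp]: "a *\<^sub>C 0 = 0"
  using bounded_linear.linear[OF bounded_linear_scaleC, of a] by (rule linear_0)

lemma Re_cinner_self: "Re (cinner x x) = (norm x)\<^sup>2"
  by (simp add: cinner_self)

lemma Re_cinner_commute: "Re (cinner x y) = Re (cinner y x)"
  by (subst cinner_commute) simp

lemma cinner_self_eq_0_iff: "cinner x x = 0 \<longleftrightarrow> x = 0"
  by (simp add: cinner_self)

lemma cinner_eq_0_commute: "cinner x y = 0 \<longleftrightarrow> cinner y x = 0"
  by (metis cinner_commute complex_cnj_zero)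

lemma cinner_ext_right:
  assumes "\<And>z. cinner z x = cinner z y"
  shows "x = y"
  using assms[of "x - y"] cinner_self_eq_0_iff[of "x - y"] by (simp add: cinner_diff_right)

lemma norm_add_squared: "(norm (x + y))\<^sup>2 = (norm x)\<^sup>2 + 2 * Re (cinner x y) + (norm y)\<^sup>2"
  using Re_cinner_commute[of x y]
  by (simp add: Re_cinner_self[symmetric] cinner_add_left cinner_add_right)

lemma norm_diff_squared: "(norm (x - y))\<^sup>2 = (norm x)\<^sup>2 - 2 * Re (cinner x y) + (norm y)\<^sup>2"
  using Re_cinner_commute[of x y]
  by (simp add: Re_cinner_self[symmetric] cinner_diff_left cinner_diff_right)

text \<open>
  Pythagoras for the component of \<open>r\<close> along \<open>w\<close>.  Nonnegativity of the left side is the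
  Cauchy-Schwarz inequality; minimality of \<open>r\<close> under such subtractions forces orthogonality.
\<close>

lemma norm_residual_squared:
  assumes "w \<noteq> 0"
  shows "(norm (r - (cinner w r / of_real ((norm w)\<^sup>2)) *\<^sub>C w))\<^sup>2
    = (norm r)\<^sup>2 - (cmod (cinner w r))\<^sup>2 / (norm w)\<^sup>2"
proof -
  define c where "c = cinner w r"
  have n: "norm w > 0" using assms by simp
  have "cinner r w = cnj c" by (metis c_def cinner_commute)
  then have "cinner r ((c / of_real ((norm w)\<^sup>2)) *\<^sub>C w) = c * cnj c / of_real ((norm w)\<^sup>2)"
    by (simp add: cinner_scaleC_right)
  also have "\<dots> = of_real ((cmod c)\<^sup>2 / (norm w)\<^sup>2)"
    by (simp add: complex_norm_square[symmetric])
  finally have 1: "Re (cinner r ((c / of_real ((norm w)\<^sup>2)) *\<^sub>C w)) = (cmod c)\<^sup>2 / (norm w)\<^sup>2"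
    using Re_complex_of_real by metis
  have 2: "(norm ((c / of_real ((norm w)\<^sup>2)) *\<^sub>C w))\<^sup>2 = (cmod c)\<^sup>2 / (norm w)\<^sup>2"
    using n by (simp add: norm_scaleC norm_divide norm_power power_mult_distrib power_divide)
      (simp add: power2_eq_square power4_eq_xxxx)
  show ?thesis unfolding norm_diff_squared c_def[symmetric] 1 2 by simp
qed

lemma cinner_Cauchy_Schwarz: "cmod (cinner x y) \<le> norm x * norm y"
proof (cases "x = 0")
  case False
  have "0 \<le> (norm y)\<^sup>2 - (cmod (cinner x y))\<^sup>2 / (norm x)\<^sup>2"
    by (subst norm_residual_squared[OF False, symmetric]) simp
  then have "(cmod (cinner x y))\<^sup>2 \<le> (norm x * norm y)\<^sup>2"
    using False by (simp add: field_simps)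
  then show ?thesis by (rule power2_le_imp_le) simp
qed simp

lemma bounded_linear_cinner_right: "bounded_linear (\<lambda>y. cinner x y)"
proof (rule bounded_linear_intro[where K = "norm x"])
  show "norm (cinner x y) \<le> norm y * norm x" for y
    using cinner_Cauchy_Schwarz[of x y] by (simp add: mult.commute)
qed (simp_all add: cinner_add_right cinner_scaleR_right scaleR_conv_of_real)

lemma bounded_bilinear_cinner: "bounded_bilinear cinner"
  by (rule bounded_bilinear.intro)
    (auto simp: cinner_add_left cinner_add_right cinner_scaleR_left cinner_scaleR_right
      scaleR_conv_of_real intro!: exI[of _ 1] cinner_Cauchy_Schwarz)

lemmas tendsto_cinner = bounded_bilinear.tendsto[OF bounded_bilinear_cinner]

section \<open>Closed subspaces and orthogonal decomposition\<close>

definition csubspace :: "'a::complex_hilbert_space set \<Rightarrow> bool"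
  where "csubspace V \<longleftrightarrow>
    0 \<in> V \<and> (\<forall>x\<in>V. \<forall>y\<in>V. x + y \<in> V) \<and> (\<forall>c. \<forall>x\<in>V. c *\<^sub>C x \<in> V)"

lemma csubspace_0: "csubspace V \<Longrightarrow> 0 \<in> V"
  and csubspace_add: "csubspace V \<Longrightarrow> x \<in> V \<Longrightarrow> y \<in> V \<Longrightarrow> x + y \<in> V"
  and csubspace_scaleC: "csubspace V \<Longrightarrow> x \<in> V \<Longrightarrow> c *\<^sub>C x \<in> V"
  by (auto simp: csubspace_def)

lemma csubspace_scaleR: "csubspace V \<Longrightarrow> x \<in> V \<Longrightarrow> r *\<^sub>R x \<in> V"
  by (metis csubspace_scaleC scaleC_of_real)

lemma csubspace_diff: "csubspace V \<Longrightarrow> x \<in> V \<Longrightarrow> y \<in> V \<Longrightarrow> x - y \<in> V"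
  using csubspace_add[of V x "- y"] csubspace_scaleC[of V y "- 1"] by (simp add: scaleC_minus_one)

lemma csubspace_closure:
  assumes V: "csubspace V"
  shows "csubspace (closure V)"
  unfolding csubspace_def
proof (intro conjI ballI allI)
  show "0 \<in> closure V" using V closure_subset csubspace_0 by blast
next
  fix x y assume "x \<in> closure V" "y \<in> closure V"
  then obtain f g where "\<forall>n. f n \<in> V" "f \<longlonglongrightarrow> x" "\<forall>n. g n \<in> V" "g \<longlonglongrightarrow> y"
    unfolding closure_sequential by blast
  then have "\<forall>n. f n + g n \<in> V" "(\<lambda>n. f n + g n) \<longlonglongrightarrow> x + y"
    using V by (auto intro: csubspace_add tendsto_add)
  then show "x + y \<in> closure V" unfolding closure_sequential by (intro exI[of _ "\<lambda>n. f n + g n"] conjI)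
next
  fix c x assume "x \<in> closure V"
  then obtain f where "\<forall>n. f n \<in> V" "f \<longlonglongrightarrow> x"
    unfolding closure_sequential by blast
  then have "\<forall>n. c *\<^sub>C f n \<in> V" "(\<lambda>n. c *\<^sub>C f n) \<longlonglongrightarrow> c *\<^sub>C x"
    using V by (auto intro: csubspace_scaleC bounded_linear.tendsto[OF bounded_linear_scaleC])
  then show "c *\<^sub>C x \<in> closure V" unfolding closure_sequential by (intro exI[of _ "\<lambda>n. c *\<^sub>C f n"] conjI)
qed

text \<open>
  The parallelogram law makes every minimising sequence Cauchy: the midpoint of two of its
  members lies in the subspace and so cannot be nearer than the infimum.
\<close>

lemma nearest_point_exists:
  assumes V: "csubspace V" and "closed V"
  obtains p where "p \<in> V" "\<And>q. q \<in> V \<Longrightarrow> norm (v - p) \<le> norm (v - q)"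
proof -
  define d where "d = infdist v V"
  have ne: "V \<noteq> {}" using csubspace_0[OF V] by auto
  have d_le: "d \<le> norm (v - q)" if "q \<in> V" for q
    using infdist_le[OF that, of v] by (simp add: d_def dist_norm)
  have d0: "d \<ge> 0" by (simp add: d_def infdist_nonneg)
  have "\<exists>p\<in>V. norm (v - p) < d + inverse (real (Suc n))" for n
  proof -
    have "infdist v V < d + inverse (real (Suc n))" by (simp add: d_def)
    then have "Inf ((\<lambda>q. norm (v - q)) ` V) < d + inverse (real (Suc n))"
      by (simp add: infdist_def ne dist_norm)
    from cInf_lessD[OF _ this] show ?thesis using ne by auto
  qed
  then obtain p where pV: "\<And>n. p n \<in> V" and pd: "\<And>n. norm (v - p n) < d + inverse (real (Suc n))"
    by metis
  \<comment> \<open>the upper bound for the squared distance of the \<open>n\<close>-th member\<close>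
  define e where "e n = (d + inverse (real (Suc n)))\<^sup>2" for n
  have lim: "(\<lambda>n. e n - d\<^sup>2) \<longlonglongrightarrow> (d + 0)\<^sup>2 - d\<^sup>2"
    unfolding e_def by (intro tendsto_intros LIMSEQ_inverse_real_of_nat)
  have par: "(norm (p m - p n))\<^sup>2 \<le> 2 * (e m - d\<^sup>2) + 2 * (e n - d\<^sup>2)" for m n
  proof -
    define q where "q = (1/2) *\<^sub>R (p m + p n)"
    have "q \<in> V" unfolding q_def using V pV by (intro csubspace_scaleR csubspace_add)
    then have "d\<^sup>2 \<le> (norm (v - q))\<^sup>2" using d0 d_le by (simp add: power_mono)
    moreover have "(v - p m) + (v - p n) = 2 *\<^sub>R (v - q)"
      by (simp add: q_def algebra_simps scaleR_2)
    then have "(norm ((v - p m) + (v - p n)))\<^sup>2 = 4 * (norm (v - q))\<^sup>2"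
      by (simp add: power_mult_distrib)
    moreover have "(norm (p m - p n))\<^sup>2 = (norm ((v - p n) - (v - p m)))\<^sup>2" by simp
    moreover have "(norm (v - p k))\<^sup>2 \<le> e k" for k
      unfolding e_def using pd[of k] by (intro power_mono) auto
    then have "(norm (v - p m))\<^sup>2 \<le> e m" "(norm (v - p n))\<^sup>2 \<le> e n" by blast+
    ultimately show ?thesis
      unfolding norm_add_squared norm_diff_squared[of "v - p n" "v - p m"]
      using Re_cinner_commute[of "v - p m" "v - p n"] by argo
  qed
  have "Cauchy p"
  proof (rule metric_CauchyI)
    fix r :: real assume r: "r > 0"
    have "eventually (\<lambda>n. e n - d\<^sup>2 < r\<^sup>2 / 4) sequentially"
      using order_tendstoD(2)[OF lim, of "r\<^sup>2 / 4"] r by simp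
    then obtain N where N: "\<And>n. n \<ge> N \<Longrightarrow> e n - d\<^sup>2 < r\<^sup>2 / 4"
      by (auto simp: eventually_sequentially)
    have "dist (p m) (p n) < r" if "m \<ge> N" "n \<ge> N" for m n
    proof -
      have "(norm (p m - p n))\<^sup>2 < r\<^sup>2" using par[of m n] N[OF that(1)] N[OF that(2)] by argo
      then show ?thesis using r by (simp add: dist_norm power2_less_imp_less)
    qed
    then show "\<exists>M. \<forall>m\<ge>M. \<forall>n\<ge>M. dist (p m) (p n) < r" by blast
  qed
  then obtain l where l: "p \<longlonglongrightarrow> l" using Cauchy_convergent convergent_def by blast
  have "l \<in> V" using \<open>closed V\<close> pV l closed_sequentially by blast
  moreover have "norm (v - l) \<le> d + 0"
  proof (rule LIMSEQ_le)
    show "(\<lambda>n. norm (v - p n)) \<longlonglongrightarrow> norm (v - l)" by (intro tendsto_intros l)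
    show "(\<lambda>n. d + inverse (real (Suc n))) \<longlonglongrightarrow> d + 0"
      by (intro tendsto_intros LIMSEQ_inverse_real_of_nat)
    show "\<exists>N. \<forall>n\<ge>N. norm (v - p n) \<le> d + inverse (real (Suc n))" using pd less_imp_le by blast
  qed
  ultimately show ?thesis using that d_le by fastforce
qed

lemma orthogonal_decomposition:
  assumes V: "csubspace V" and "closed V"
  obtains p where "p \<in> V" "\<And>w. w \<in> V \<Longrightarrow> cinner w (v - p) = 0"
proof -
  obtain p where p: "p \<in> V" "\<And>q. q \<in> V \<Longrightarrow> norm (v - p) \<le> norm (v - q)"
    using nearest_point_exists[OF assms] by blast
  have "cinner w (v - p) = 0" if w: "w \<in> V" for w
  proof (cases "w = 0")
    case False
    let ?a = "cinner w (v - p) / of_real ((norm w)\<^sup>2)"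
    have "p + ?a *\<^sub>C w \<in> V" using V p w by (intro csubspace_add csubspace_scaleC)
    then have "(norm (v - p))\<^sup>2 \<le> (norm (v - p - ?a *\<^sub>C w))\<^sup>2"
      using p(2) by (simp add: power_mono diff_diff_eq)
    then have "(cmod (cinner w (v - p)))\<^sup>2 / (norm w)\<^sup>2 \<le> 0"
      unfolding norm_residual_squared[OF False] by simp
    then show ?thesis using False by (simp add: divide_le_0_iff)
  qed simp
  with p(1) show ?thesis using that by blast
qed

text \<open>
  Projecting \<open>w\<close> onto \<open>V\<close> leaves a remainder orthogonal to \<open>V\<close>, hence by hypothesis to \<open>w\<close> and so
  to itself.  With this test a vector is placed in a closed span without writing it as a limit.
\<close>

lemma bipolar:
  assumes V: "csubspace V" "closed V"
    and perp: "\<And>r. (\<And>z. z \<in> V \<Longrightarrow> cinner z r = 0) \<Longrightarrow> cinner r w = 0"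
  shows "w \<in> V"
proof -
  obtain p where p: "p \<in> V" "\<And>z. z \<in> V \<Longrightarrow> cinner z (w - p) = 0"
    using orthogonal_decomposition[OF V] by blast
  have "cinner (w - p) (w - p) = cinner (w - p) w - cinner (w - p) p"
    by (simp add: cinner_diff_right)
  also have "\<dots> = 0" using perp[OF p(2)] p cinner_eq_0_commute by fastforce
  finally have "w = p" by (simp add: cinner_self_eq_0_iff)
  then show ?thesis using p(1) by simp
qed

section \<open>Riesz representation and adjoints\<close>

lemma bounded_operatorsD: "x \<in> bounded_operators \<Longrightarrow> blinfun_apply x (c *\<^sub>C v) = c *\<^sub>C x v"
  by (simp add: bounded_operators_def)

text \<open>
  A nonzero functional is represented by a multiple of any vector \<open>r\<close> orthogonal to its kernel
  and not in it, since \<open>f r v - f v r\<close> always lies in the kernel.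
\<close>

lemma Riesz_representation:
  fixes f :: "'a::complex_hilbert_space \<Rightarrow> complex"
  assumes f: "bounded_linear f" and fC: "\<And>c v. f (c *\<^sub>C v) = c * f v"
  obtains z where "\<And>v. f v = cinner z v"
proof (cases "\<forall>v. f v = 0")
  case True
  then show ?thesis using that[of 0] by simp
next
  case False
  then obtain u where u: "f u \<noteq> 0" by blast
  interpret f: bounded_linear f by (rule f)
  have "csubspace {v. f v = 0}" by (simp add: csubspace_def f.zero f.add fC)
  moreover have "closed {v. f v = 0}"
    by (intro closed_Collect_eq continuous_on_const linear_continuous_on f)
  ultimately obtain p where "p \<in> {v. f v = 0}" "\<And>w. w \<in> {v. f v = 0} \<Longrightarrow> cinner w (u - p) = 0"
    by (rule orthogonal_decomposition[where v = u]) blast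
  then have p: "f p = 0" "\<And>w. f w = 0 \<Longrightarrow> cinner w (u - p) = 0" by simp_all
  define r where "r = u - p"
  have fr: "f r = f u" using p by (simp add: r_def f.diff)
  then have r: "r \<noteq> 0" using u f.zero by auto
  have main: "f r * cinner r v = f v * of_real ((norm r)\<^sup>2)" for v
  proof -
    have "f (f r *\<^sub>C v - f v *\<^sub>C r) = 0" by (simp add: f.diff fC)
    from p(2)[OF this] have "cinner r (f r *\<^sub>C v - f v *\<^sub>C r) = 0"
      unfolding r_def[symmetric] by (simp add: cinner_eq_0_commute)
    then show ?thesis by (simp add: cinner_diff_right cinner_scaleC_right cinner_self)
  qed
  have "f v = cinner ((cnj (f r) / of_real ((norm r)\<^sup>2)) *\<^sub>C r) v" for v
    using main[of v] r by (simp add: cinner_scaleC_left field_simps)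
  then show ?thesis using that by blast
qed

lemma adjoint_exists:
  fixes x :: "'a::complex_hilbert_space \<Rightarrow>\<^sub>L 'a"
  assumes x: "x \<in> bounded_operators"
  obtains y where "\<And>v w. cinner (blinfun_apply x v) w = cinner v (blinfun_apply y w)"
proof -
  have "\<exists>z. \<forall>v. cinner w (x v) = cinner z v" for w
  proof -
    have "bounded_linear (\<lambda>v. cinner w (x v))"
      by (rule bounded_linear_compose[OF bounded_linear_cinner_right blinfun.bounded_linear_right])
    then show ?thesis
      using Riesz_representation[of "\<lambda>v. cinner w (x v)"] bounded_operatorsD[OF x]
      by (metis cinner_scaleC_right)
  qed
  then obtain g where g': "\<And>w v. cinner w (x v) = cinner (g w) v" by metis
  then have g: "cinner (x v) w = cinner v (g w)" for v w by (metis cinner_commute)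
  have "bounded_linear g"
  proof (rule bounded_linear_intro[where K = "norm x"])
    show "g (v + w) = g v + g w" for v w
      by (rule cinner_ext_right) (simp add: cinner_add_right flip: g)
    show "g (r *\<^sub>R v) = r *\<^sub>R g v" for r v
      by (rule cinner_ext_right) (simp add: cinner_scaleR_right flip: g)
    show "norm (g w) \<le> norm w * norm x" for w
    proof (cases "g w = 0")
      case False
      have "(norm (g w))\<^sup>2 = cmod (cinner (g w) (g w))" by (simp add: cinner_self norm_power)
      also have "\<dots> = cmod (cinner w (x (g w)))" by (simp add: g')
      also have "\<dots> \<le> norm w * norm (x (g w))" by (rule cinner_Cauchy_Schwarz)
      also have "\<dots> \<le> norm w * (norm x * norm (g w))"
        by (intro mult_left_mono norm_blinfun) simp
      finally have "norm (g w) * norm (g w) \<le> (norm w * norm x) * norm (g w)"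
        by (simp add: power2_eq_square)
      then show ?thesis using False by simp
    qed simp
  qed
  then have "cinner (x v) w = cinner v (Blinfun g w)" for v w
    by (simp add: bounded_linear_Blinfun_apply g)
  then show ?thesis using that by blast
qed

text \<open>
  The defining property of the adjoint determines it, so the definite description can be
  evaluated by exhibiting an operator with that property.
\<close>

lemma adj_eqI:
  assumes y: "\<And>v w. cinner (blinfun_apply x v) w = cinner v (blinfun_apply y w)"
  shows "adj x = y"
  unfolding adj_def
proof (rule the_equality)
  show "\<forall>v w. cinner (x v) w = cinner v (y w)" using y by blast
next
  fix z assume "\<forall>v w. cinner (x v) w = cinner v (blinfun_apply z w)"
  with y show "z = y" by (metis blinfun_eqI cinner_ext_right)
qed

lemma cinner_adj_right:
  "x \<in> bounded_operators \<Longrightarrow> cinner v (blinfun_apply (adj x) w) = cinner (blinfun_apply x v) w"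
  by (metis adj_eqI adjoint_exists)

lemma cinner_adj_left:
  "x \<in> bounded_operators \<Longrightarrow> cinner (blinfun_apply (adj x) v) w = cinner v (blinfun_apply x w)"
  by (metis cinner_adj_right cinner_commute)

lemma adj_in_bounded_operators:
  assumes "x \<in> bounded_operators"
  shows "adj x \<in> bounded_operators"
proof -
  have "adj x (c *\<^sub>C v) = c *\<^sub>C adj x v" for c v
    by (rule cinner_ext_right) (simp add: assms cinner_adj_right cinner_scaleC_right)
  then show ?thesis by (simp add: bounded_operators_def)
qed

lemma adj_adj: "x \<in> bounded_operators \<Longrightarrow> adj (adj x) = x"
  by (rule adj_eqI) (simp add: cinner_adj_left)

lemma compose_in_bounded_operators:
  "x \<in> bounded_operators \<Longrightarrow> y \<in> bounded_operators \<Longrightarrow> x o\<^sub>L y \<in> bounded_operators"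
  by (simp add: bounded_operators_def)

lemma diff_in_bounded_operators:
  "x \<in> bounded_operators \<Longrightarrow> y \<in> bounded_operators \<Longrightarrow> x - y \<in> bounded_operators"
  by (simp add: bounded_operators_def blinfun.diff_left scaleC_diff_right)

lemma adj_compose:
  "x \<in> bounded_operators \<Longrightarrow> y \<in> bounded_operators \<Longrightarrow> adj (x o\<^sub>L y) = adj y o\<^sub>L adj x"
  by (rule adj_eqI) (simp add: cinner_adj_right)

lemma adj_diff:
  "x \<in> bounded_operators \<Longrightarrow> y \<in> bounded_operators \<Longrightarrow> adj (x - y) = adj x - adj y"
  by (rule adj_eqI) (simp add: blinfun.diff_left cinner_adj_right cinner_diff_left cinner_diff_right)

lemma projection_operator_exists:
  fixes V :: "'a::complex_hilbert_space set"
  assumes V: "csubspace V" "closed V"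
  obtains E where "E \<in> bounded_operators" "adj E = E" "range (blinfun_apply E) \<subseteq> V"
    "\<And>v. v \<in> V \<Longrightarrow> blinfun_apply E v = v"
    "\<And>v w. w \<in> V \<Longrightarrow> cinner w (v - blinfun_apply E v) = 0"
proof -
  have "\<exists>p. p \<in> V \<and> (\<forall>w\<in>V. cinner w (v - p) = 0)" for v
    by (rule orthogonal_decomposition[OF V, of v]) blast
  then have "\<forall>v. \<exists>p. p \<in> V \<and> (\<forall>w\<in>V. cinner w (v - p) = 0)" ..
  then obtain g where gV: "\<And>v. g v \<in> V" and gp: "\<And>v w. w \<in> V \<Longrightarrow> cinner w (v - g v) = 0"
    unfolding choice_iff by blast
  have unique: "g v = p" if "p \<in> V" "\<And>w. w \<in> V \<Longrightarrow> cinner w (v - p) = 0" for v p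
  proof -
    have d: "g v - p \<in> V" using V(1) gV that(1) by (rule csubspace_diff)
    have "cinner (g v - p) (g v - p) = cinner (g v - p) (v - p) - cinner (g v - p) (v - g v)"
      by (simp add: cinner_diff_right)
    also have "\<dots> = 0" using that(2)[OF d] gp[OF d] by simp
    finally show ?thesis by (simp add: cinner_self_eq_0_iff)
  qed
  have gC: "g (c *\<^sub>C v) = c *\<^sub>C g v" for c v
    using gV gp V(1) by (intro unique csubspace_scaleC)
      (simp_all add: cinner_scaleC_right flip: scaleC_diff_right)
  have "bounded_linear g"
  proof (rule bounded_linear_intro[where K = 1])
    show "g (v + w) = g v + g w" for v w
      using gp[of _ v] gp[of _ w] by (intro unique csubspace_add V(1) gV)
        (simp add: cinner_diff_right cinner_add_right)
    show "g (r *\<^sub>R v) = r *\<^sub>R g v" for r v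
      using gC[of "of_real r" v] by (simp add: scaleC_of_real)
    show "norm (g v) \<le> norm v * 1" for v
    proof -
      have "(norm v)\<^sup>2 = (norm (g v))\<^sup>2 + (norm (v - g v))\<^sup>2"
        using norm_add_squared[of "g v" "v - g v"] gp[OF gV, of v v] by simp
      then show ?thesis by (simp add: power2_le_imp_le)
    qed
  qed
  then have E: "Blinfun g v = g v" for v by (simp add: bounded_linear_Blinfun_apply)
  have sa: "cinner (g v) w = cinner v (g w)" for v w
  proof -
    have "cinner (g v) w = cinner (g v) (g w)" using gp[OF gV, of v w] by (simp add: cinner_diff_right)
    moreover have "cinner (v - g v) (g w) = 0" using gp[OF gV, of w v] by (simp add: cinner_eq_0_commute)
    ultimately show ?thesis by (simp add: cinner_diff_left)
  qed
  show ?thesis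
  proof (rule that[of "Blinfun g"])
    show "adj (Blinfun g) = Blinfun g" by (rule adj_eqI) (simp add: E sa)
    show "Blinfun g v = v" if "v \<in> V" for v using that by (simp add: E unique)
  qed (auto simp: E gV gp gC bounded_operators_def)
qed

section \<open>Richardson iteration for positive operators\<close>

text \<open>
  One step of Richardson's iteration for the equation \<open>s w = 0\<close>, i.e. the operator \<open>1 - cs\<close>.
  It is a plain function so that its powers can be written with \<open>^^\<close>, the type of bounded
  linear functions being no monoid under composition.
\<close>

definition richardson :: "('a::complex_hilbert_space \<Rightarrow>\<^sub>L 'a) \<Rightarrow> real \<Rightarrow> 'a \<Rightarrow> 'a"
  where "richardson s c w = w - c *\<^sub>R blinfun_apply s w"

text \<open>
  Positivity of \<open>s\<close> at the image \<open>w - c s w\<close>, rather than at \<open>w\<close>, gives the bound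
  \<open>c |s w|^2 \<le> \<langle>w, s w\<rangle>\<close>, and expanding \<open>|w - c s w|^2\<close> then gives the claim.  Only an invariant
  subspace \<open>R\<close> is considered because \<open>s\<close> will also be a supremum of positive operators, known
  to be positive only on certain ranges.
\<close>

lemma richardson_contraction:
  fixes s :: "'a::complex_hilbert_space \<Rightarrow>\<^sub>L 'a"
  assumes s: "s \<in> bounded_operators" "adj s = s"
    and R: "csubspace R" "\<And>w. w \<in> R \<Longrightarrow> blinfun_apply s w \<in> R"
    and pos: "\<And>w. w \<in> R \<Longrightarrow> 0 \<le> Re (cinner w (blinfun_apply s w))"
    and c: "0 \<le> c" "c * norm s \<le> 1" and w: "w \<in> R"
  shows "(norm (richardson s c w))\<^sup>2 + (norm (c *\<^sub>R blinfun_apply s w))\<^sup>2 \<le> (norm w)\<^sup>2"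
proof -
  define a where "a = Re (cinner w (s w))"
  define b where "b = (norm (s w))\<^sup>2"
  define d where "d = Re (cinner (s w) (s (s w)))"
  have sym: "cinner w (s (s w)) = cinner (s w) (s w)"
    using cinner_adj_right[OF s(1), of w "s w"] s(2) by simp
  have "w - c *\<^sub>R s w \<in> R" using R w by (intro csubspace_diff csubspace_scaleR)
  from pos[OF this] have "0 \<le> a - 2 * c * b + c * (c * d)"
    by (simp add: blinfun.diff_right blinfun.scaleR_right cinner_diff_left cinner_diff_right
        cinner_scaleR_left cinner_scaleR_right sym a_def b_def d_def Re_cinner_self algebra_simps)
  moreover have "c * (c * d) \<le> c * b"
  proof -
    have "d \<le> norm (s w) * norm (s (s w))"
      using complex_Re_le_cmod cinner_Cauchy_Schwarz order_trans d_def by metis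
    also have "\<dots> \<le> norm (s w) * (norm s * norm (s w))"
      by (intro mult_left_mono norm_blinfun) simp
    finally have "d \<le> norm s * b" by (simp add: b_def power2_eq_square mult_ac)
    then have "c * d \<le> (c * norm s) * b" using c(1) by (simp add: mult_left_mono mult.assoc)
    also have "\<dots> \<le> 1 * b" using c(2) by (intro mult_right_mono) (simp_all add: b_def)
    finally show ?thesis using c(1) by (simp add: mult_left_mono)
  qed
  ultimately have "c * b \<le> a" by argo
  then have "c * (c * b) \<le> c * a" using c(1) by (rule mult_left_mono)
  moreover have "(norm (c *\<^sub>R s w))\<^sup>2 = c * (c * b)"
    by (simp add: b_def power_mult_distrib power2_eq_square)
  moreover have "Re (cinner w (c *\<^sub>R s w)) = c * a" by (simp add: cinner_scaleR_right a_def)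
  ultimately show ?thesis unfolding richardson_def norm_diff_squared by argo
qed

lemma richardson_iterate_add:
  "(richardson s c ^^ n) (v + w) = (richardson s c ^^ n) v + (richardson s c ^^ n) w"
  by (induction n) (simp_all add: richardson_def blinfun.add_right algebra_simps)

lemma richardson_iterate_scaleC:
  assumes "s \<in> bounded_operators"
  shows "(richardson s c ^^ n) (a *\<^sub>C v) = a *\<^sub>C (richardson s c ^^ n) v"
proof (induction n)
  case (Suc n)
  have "c *\<^sub>R (a *\<^sub>C u) = a *\<^sub>C (c *\<^sub>R u)" for u :: 'a
    by (simp add: scaleC_of_real[symmetric] scaleC_scaleC mult.commute)
  with Suc show ?case
    by (simp add: richardson_def bounded_operatorsD[OF assms] scaleC_diff_right)
qed simp

lemma richardson_iterate_diff:
  "(richardson s c ^^ n) (v - w) = (richardson s c ^^ n) v - (richardson s c ^^ n) w"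
  using richardson_iterate_add[of n s c "v - w" w] by simp

lemma richardson_iterate_commute:
  "(richardson s c ^^ n) (blinfun_apply s v) = blinfun_apply s ((richardson s c ^^ n) v)"
  by (induction n) (simp_all add: richardson_def blinfun.diff_right blinfun.scaleR_right)

lemma richardson_iterate_fixed:
  "blinfun_apply s v = 0 \<Longrightarrow> (richardson s c ^^ n) v = v"
  by (induction n) (simp_all add: richardson_def)

lemma richardson_iterate_contraction:
  fixes s :: "'a::complex_hilbert_space \<Rightarrow>\<^sub>L 'a"
  assumes s: "s \<in> bounded_operators" "adj s = s"
    and R: "csubspace R" "\<And>w. w \<in> R \<Longrightarrow> blinfun_apply s w \<in> R"
    and pos: "\<And>w. w \<in> R \<Longrightarrow> 0 \<le> Re (cinner w (blinfun_apply s w))"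
    and c: "0 \<le> c" "c * norm s \<le> 1" and w: "w \<in> R"
  shows "(richardson s c ^^ n) w \<in> R \<and> norm ((richardson s c ^^ n) w) \<le> norm w"
proof (induction n)
  case (Suc n)
  let ?u = "(richardson s c ^^ n) w"
  have "richardson s c u \<in> R" if "u \<in> R" for u
    unfolding richardson_def using that R by (intro csubspace_diff csubspace_scaleR)
  then have "richardson s c ?u \<in> R" using Suc by blast
  moreover have "(norm (richardson s c ?u))\<^sup>2 + (norm (c *\<^sub>R s ?u))\<^sup>2 \<le> (norm ?u)\<^sup>2"
    using richardson_contraction[OF s R pos c] Suc by blast
  then have "(norm (richardson s c ?u))\<^sup>2 \<le> (norm ?u)\<^sup>2"
    using zero_le_power2[of "norm (c *\<^sub>R s ?u)"] by argo
  then have "norm (richardson s c ?u) \<le> norm ?u" by (rule power2_le_imp_le) simp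
  ultimately show ?case using Suc by simp
qed (simp add: w)

text \<open>
  The orbit of \<open>u\<close> has decreasing norms, so by \<open>richardson_contraction\<close> the increments \<open>c s (1 - cs)^n u\<close> tend
  to 0, which proves convergence for vectors in the range of \<open>s\<close>.  The vectors whose
  orbit tends to 0 form a closed subspace, and what is orthogonal to the range lies in the kernel.
\<close>

lemma richardson_tendsto_0:
  fixes s :: "'a::complex_hilbert_space \<Rightarrow>\<^sub>L 'a"
  assumes s: "s \<in> bounded_operators" "adj s = s"
    and pos: "\<And>w. 0 \<le> Re (cinner w (blinfun_apply s w))"
    and c: "0 < c" "c * norm s \<le> 1"
    and w: "\<And>k. blinfun_apply s k = 0 \<Longrightarrow> cinner k w = 0"
  shows "(\<lambda>n. (richardson s c ^^ n) w) \<longlonglongrightarrow> 0"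
proof -
  let ?B = "richardson s c"
  have UN: "csubspace (UNIV :: 'a set)" by (simp add: csubspace_def)
  have contr: "norm ((?B ^^ n) v) \<le> norm v" for n v
    using richardson_iterate_contraction[OF s UN _ pos _ c(2), of v n] c(1) by simp
  have range: "(\<lambda>n. (?B ^^ n) (s u)) \<longlonglongrightarrow> 0" for u
  proof -
    define d where "d n = (norm ((?B ^^ n) u))\<^sup>2" for n
    have step: "(norm (c *\<^sub>R s ((?B ^^ n) u)))\<^sup>2 \<le> d n - d (Suc n)" for n
      using richardson_contraction[OF s UN _ pos _ c(2), of "(?B ^^ n) u"] c(1)
      by (simp add: d_def)
    have "d (Suc n) \<le> d n" for n
      using step[of n] zero_le_power2[of "norm (c *\<^sub>R s ((?B ^^ n) u))"] by argo
    then have "decseq d" by (simp add: decseq_Suc_iff)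
    then obtain l where l: "d \<longlonglongrightarrow> l"
      using decseq_convergent[of d 0] by (auto simp: d_def)
    have lim: "(\<lambda>n. d n - d (Suc n)) \<longlonglongrightarrow> l - l"
      by (intro tendsto_diff l LIMSEQ_Suc)
    have "(\<lambda>n. (norm (c *\<^sub>R s ((?B ^^ n) u)))\<^sup>2) \<longlonglongrightarrow> 0"
      by (rule tendsto_sandwich[where f = "\<lambda>_. 0" and h = "\<lambda>n. d n - d (Suc n)"])
        (use lim step in simp_all)
    from tendsto_real_sqrt[OF this]
    have "(\<lambda>n. norm (c *\<^sub>R s ((?B ^^ n) u))) \<longlonglongrightarrow> 0"
      by (simp only: real_sqrt_abs abs_norm_cancel real_sqrt_zero)
    then have "(\<lambda>n. c *\<^sub>R s ((?B ^^ n) u)) \<longlonglongrightarrow> 0"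
      by (rule tendsto_norm_zero_cancel)
    then have "(\<lambda>n. (1 / c) *\<^sub>R (c *\<^sub>R s ((?B ^^ n) u))) \<longlonglongrightarrow> (1 / c) *\<^sub>R 0"
      by (intro tendsto_intros)
    then show ?thesis using c(1) by (simp add: richardson_iterate_commute)
  qed
  define Z where "Z = {v. (\<lambda>n. (?B ^^ n) v) \<longlonglongrightarrow> 0}"
  have "csubspace Z"
    unfolding csubspace_def
  proof (intro conjI ballI allI)
    show "0 \<in> Z" by (simp add: Z_def richardson_iterate_fixed)
  next
    fix x y assume "x \<in> Z" "y \<in> Z"
    then show "x + y \<in> Z"
      using tendsto_add[of _ 0 _ _ 0] by (fastforce simp: Z_def richardson_iterate_add)
  next
    fix a x assume "x \<in> Z"
    then show "a *\<^sub>C x \<in> Z"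
      using bounded_linear.tendsto_zero[OF bounded_linear_scaleC]
      by (auto simp: Z_def richardson_iterate_scaleC[OF s(1)])
  qed
  moreover have "closed Z"
    unfolding closed_sequential_limits
  proof (intro allI impI, elim conjE)
    fix f x assume f: "\<forall>n. f n \<in> Z" "f \<longlonglongrightarrow> x"
    have "\<exists>N. \<forall>n\<ge>N. norm ((?B ^^ n) x - 0) < e" if e: "e > 0" for e
    proof -
      obtain m where m: "norm (f m - x) < e / 2"
        using LIMSEQ_D[OF f(2), of "e / 2"] e by auto
      from f(1) have "(\<lambda>n. (?B ^^ n) (f m)) \<longlonglongrightarrow> 0" by (simp add: Z_def)
      from LIMSEQ_D[OF this, of "e / 2"] e obtain N
        where N: "\<And>n. n \<ge> N \<Longrightarrow> norm ((?B ^^ n) (f m)) < e / 2" by auto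
      have "norm ((?B ^^ n) x) < e" if "n \<ge> N" for n
      proof -
        have "norm ((?B ^^ n) x) \<le> norm ((?B ^^ n) (f m)) + norm ((?B ^^ n) (f m - x))"
          unfolding richardson_iterate_diff by (metis norm_minus_commute norm_triangle_sub)
        also have "\<dots> < e / 2 + e / 2"
          using N[OF that] contr[of n "f m - x"] m by (intro add_strict_mono) auto
        finally show ?thesis by simp
      qed
      then show ?thesis by auto
    qed
    then have "(\<lambda>n. (?B ^^ n) x) \<longlonglongrightarrow> 0" by (rule LIMSEQ_I)
    then show "x \<in> Z" by (simp add: Z_def)
  qed
  ultimately have "w \<in> Z"
  proof (rule bipolar)
    fix r assume r: "\<And>z. z \<in> Z \<Longrightarrow> cinner z r = 0"
    have "cinner (s (s r)) r = 0" using r range by (simp add: Z_def)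
    then have "cinner (s r) (s r) = 0"
      using cinner_adj_right[OF s(1), of "s r" r] s(2) by simp
    then show "cinner r w = 0" using w cinner_self_eq_0_iff by blast
  qed
  then show ?thesis by (simp add: Z_def)
qed

section \<open>Support projections in a von Neumann algebra\<close>

text \<open>
  The strong topology is pointwise convergence, whose basic neighbourhoods constrain only
  finitely many vectors.
\<close>

lemma strongly_closed_approximation:
  fixes x :: "'a::real_normed_vector \<Rightarrow>\<^sub>L 'b::real_normed_vector"
  assumes M: "closedin strong_operator_topology M"
    and approx: "\<And>F e. finite F \<Longrightarrow> 0 < e \<Longrightarrow>
      \<exists>y\<in>M. \<forall>v\<in>F. norm (blinfun_apply y v - blinfun_apply x v) < e"
  shows "x \<in> M"
proof (rule ccontr)
  assume x: "x \<notin> M"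
  have "openin (pullback_topology UNIV blinfun_apply euclidean) (- M)"
    using M unfolding closedin_def strong_operator_topology_topspace Compl_eq_Diff_UNIV
    unfolding strong_operator_topology_def by blast
  then obtain U where U: "open U" "- M = blinfun_apply -` U"
    unfolding openin_pullback_topology by auto
  have "openin (product_topology (\<lambda>i. euclidean) UNIV) U" "blinfun_apply x \<in> U"
    using U x by (auto simp: open_fun_def)
  from product_topology_open_contains_basis[OF this]
  obtain X where X: "\<And>v. blinfun_apply x v \<in> X v" "\<And>v. open (X v)" "finite {v. X v \<noteq> UNIV}"
    "(\<Pi>\<^sub>E v\<in>UNIV. X v) \<subseteq> U"
    by (auto simp: PiE_iff)
  let ?F = "{v. X v \<noteq> UNIV}"
  have "\<forall>v. \<exists>e>0. \<forall>y. norm (y - x v) < e \<longrightarrow> y \<in> X v"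
    using X(1,2) by (metis open_dist dist_norm)
  then obtain e where e: "\<And>v. e v > 0" "\<And>v y. norm (y - x v) < e v \<Longrightarrow> y \<in> X v" by metis
  define d where "d = Min (insert 1 (e ` ?F))"
  have d: "d > 0" "\<And>v. v \<in> ?F \<Longrightarrow> d \<le> e v" using X(3) e(1) by (auto simp: d_def)
  from approx[OF X(3) d(1)] obtain y where y: "y \<in> M" "\<And>v. v \<in> ?F \<Longrightarrow> norm (y v - x v) < d" by blast
  have "y v \<in> X v" for v
    using y(2)[of v] d(2)[of v] e(2)[of "y v" v] by (cases "v \<in> ?F") auto
  then have "blinfun_apply y \<in> U" using X(4) by (auto simp: PiE_iff)
  then show False using U(2) y(1) by auto
qed

lemma cstar_subalgebraD:
  assumes "cstar_subalgebra M"
  shows "M \<subseteq> bounded_operators" "0 \<in> M" "x \<in> M \<Longrightarrow> y \<in> M \<Longrightarrow> x + y \<in> M"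
    "x \<in> M \<Longrightarrow> scaleC_blinfun c x \<in> M" "x \<in> M \<Longrightarrow> y \<in> M \<Longrightarrow> x o\<^sub>L y \<in> M" "x \<in> M \<Longrightarrow> adj x \<in> M"
  using assms by (auto simp: cstar_subalgebra_def)

lemma cstar_subalgebra_scaleR:
  assumes "cstar_subalgebra M" "x \<in> M"
  shows "r *\<^sub>R x \<in> M"
proof -
  have "scaleC_blinfun (of_real r) x = r *\<^sub>R x"
    by (rule blinfun_eqI) (simp add: scaleC_blinfun.rep_eq scaleC_of_real blinfun.scaleR_left)
  then show ?thesis using cstar_subalgebraD(4)[OF assms, of "of_real r"] by simp
qed

lemma cstar_subalgebra_diff:
  assumes "cstar_subalgebra M" "x \<in> M" "y \<in> M"
  shows "x - y \<in> M"
  using cstar_subalgebraD(3)[OF assms(1,2) cstar_subalgebra_scaleR[OF assms(1,3), of "- 1"]] by simp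

lemma cstar_subalgebra_sum:
  assumes "cstar_subalgebra M" "\<And>i. i \<in> F \<Longrightarrow> f i \<in> M"
  shows "(\<Sum>i\<in>F. f i) \<in> M"
  using assms(2) by (induction F rule: infinite_finite_induct) (auto intro: cstar_subalgebraD[OF assms(1)])

text \<open>
  Since \<open>1 - (1 - cs)^n\<close> has no constant term, it lies in the algebra whether or not the
  identity does.
\<close>

lemma richardson_iterate_in_algebra:
  assumes M: "cstar_subalgebra M" and s: "s \<in> M"
  shows "\<exists>h\<in>M. \<forall>v. v - blinfun_apply h v = (richardson s c ^^ n) v"
proof (induction n)
  case 0
  show ?case by (rule bexI[OF _ cstar_subalgebraD(2)[OF M]]) simp
next
  case (Suc n)
  then obtain h where h: "h \<in> M" "\<And>v. v - blinfun_apply h v = (richardson s c ^^ n) v" by blast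
  let ?h = "h + c *\<^sub>R (s - (s o\<^sub>L h))"
  have "?h \<in> M" using h(1) s M
    by (intro cstar_subalgebraD(3) cstar_subalgebra_scaleR cstar_subalgebra_diff cstar_subalgebraD(5))
  moreover have "v - blinfun_apply ?h v = (richardson s c ^^ Suc n) v" for v
  proof -
    have "(richardson s c ^^ Suc n) v = richardson s c (v - h v)" by (simp add: h(2))
    also have "\<dots> = v - ?h v" by (simp add: richardson_def blinfun.bilinear_simps algebra_simps)
    finally show ?thesis by simp
  qed
  ultimately show ?case by blast
qed

text \<open>
  The projection is \<open>P = 1 - E\<close> with \<open>E\<close> the projection onto the common kernel \<open>K\<close>.  For the
  membership in \<open>M\<close>, approximate the finitely many given vectors \<open>P v\<close> by vectors that are
  orthogonal to the common kernel of a finite \<open>F \<subseteq> S\<close>, and iterate with the sum of \<open>x*x\<close> over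
  \<open>F\<close>, whose kernel is exactly that of \<open>F\<close>.  The iterates fix \<open>E v \<in> K\<close>, drive the
  approximating vectors to 0, and do not enlarge the approximation error.
\<close>

theorem support_projection_exists:
  fixes M :: "('a::complex_hilbert_space \<Rightarrow>\<^sub>L 'a) set"
  assumes vN: "von_neumann_algebra M" and S: "S \<subseteq> M"
  obtains P where "P \<in> projections M"
    "\<And>k. blinfun_apply P k = 0 \<longleftrightarrow> (\<forall>x\<in>S. blinfun_apply x k = 0)"
proof -
  have M: "cstar_subalgebra M" and MS: "closedin strong_operator_topology M"
    using vN by (simp_all add: von_neumann_algebra_def)
  note MB = cstar_subalgebraD(1)[OF M]
  have SB: "x \<in> bounded_operators" if "x \<in> S" for x using that S MB by blast
  define K where "K = {k. \<forall>x\<in>S. blinfun_apply x k = 0}"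
  have "csubspace K"
    by (auto simp: K_def csubspace_def blinfun.add_right SB bounded_operatorsD)
  moreover have "closed K"
  proof -
    have "K = (\<Inter>x\<in>S. {k. blinfun_apply x k = 0})" by (auto simp: K_def)
    then show ?thesis
      by (auto intro!: closed_Collect_eq continuous_on_const linear_continuous_on blinfun.bounded_linear_right)
  qed
  ultimately obtain E where E: "E \<in> bounded_operators" "adj E = E" "range (blinfun_apply E) \<subseteq> K"
    "\<And>v. v \<in> K \<Longrightarrow> blinfun_apply E v = v" "\<And>v w. w \<in> K \<Longrightarrow> cinner w (v - blinfun_apply E v) = 0"
    using projection_operator_exists by blast
  define P where "P = id_blinfun - E"
  have P: "P v = v - E v" for v by (simp add: P_def blinfun.diff_left)
  have idB: "id_blinfun \<in> bounded_operators" by (simp add: bounded_operators_def)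
  have Padj: "adj P = P"
    using adj_diff[OF idB E(1)] E(2) adj_eqI[of id_blinfun id_blinfun] by (simp add: P_def)
  have PP: "P o\<^sub>L P = P"
    using E(3,4) by (intro blinfun_eqI) (auto simp: P blinfun.diff_right)
  have Pker: "P k = 0 \<longleftrightarrow> k \<in> K" for k
  proof
    assume "P k = 0"
    then have "k = E k" by (simp add: P)
    then show "k \<in> K" using E(3) by (metis range_subsetD)
  qed (simp add: P E(4))

  define T where "T F = (\<Sum>x\<in>F. adj x o\<^sub>L x)" for F :: "('a \<Rightarrow>\<^sub>L 'a) set"
  have T_cinner: "cinner v (T F w) = (\<Sum>x\<in>F. cinner (blinfun_apply x v) (blinfun_apply x w))"
    if "F \<subseteq> S" for F v w
    using that SB by (auto simp: T_def blinfun.sum_left cinner_sum_right cinner_adj_right intro!: sum.cong)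
  have T_M: "T F \<in> M" if "F \<subseteq> S" for F
    unfolding T_def using that S by (intro cstar_subalgebra_sum[OF M] cstar_subalgebraD[OF M]) auto
  have T_sa: "adj (T F) = T F" if "F \<subseteq> S" for F
  proof (rule adj_eqI)
    fix v w
    have "cinner (T F v) w = cnj (cinner w (T F v))" by (rule cinner_commute)
    also have "\<dots> = (\<Sum>x\<in>F. cnj (cinner (blinfun_apply x w) (blinfun_apply x v)))"
      by (simp add: T_cinner[OF that])
    also have "\<dots> = cinner v (T F w)"
      unfolding T_cinner[OF that] by (rule sum.cong[OF refl]) (rule cinner_commute[symmetric])
    finally show "cinner (T F v) w = cinner v (T F w)" .
  qed
  have T_pos: "0 \<le> Re (cinner w (T F w))" if "F \<subseteq> S" for F w
    by (simp add: T_cinner[OF that] Re_cinner_self sum_nonneg)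
  have T_ker: "blinfun_apply x k = 0" if "finite F" "F \<subseteq> S" "T F k = 0" "x \<in> F" for F x k
  proof -
    have "0 = Re (cinner k (T F k))" by (simp add: that(3))
    also have "\<dots> = (\<Sum>x\<in>F. (norm (blinfun_apply x k))\<^sup>2)" by (simp add: T_cinner[OF that(2)] Re_cinner_self)
    finally have "(\<Sum>x\<in>F. (norm (blinfun_apply x k))\<^sup>2) = 0" by simp
    then have "\<forall>x\<in>F. (norm (blinfun_apply x k))\<^sup>2 = 0"
      by (subst (asm) sum_nonneg_eq_0_iff[OF that(1)]) simp_all
    then show ?thesis using that(4) by simp
  qed

  \<comment> \<open>a dense subspace of the range of \<open>P\<close>, each vector being controlled by finitely many elements of \<open>S\<close>\<close>
  define D where "D = {w. \<exists>F. finite F \<and> F \<subseteq> S \<and>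
    (\<forall>k. (\<forall>x\<in>F. blinfun_apply x k = 0) \<longrightarrow> cinner k w = 0)}"
  have D: "csubspace D"
    unfolding csubspace_def
  proof (intro conjI ballI allI)
    show "0 \<in> D" unfolding D_def by force
  next
    fix v w assume "v \<in> D" "w \<in> D"
    then obtain F G where "finite F" "F \<subseteq> S" "\<forall>k. (\<forall>x\<in>F. blinfun_apply x k = 0) \<longrightarrow> cinner k v = 0"
      "finite G" "G \<subseteq> S" "\<forall>k. (\<forall>x\<in>G. blinfun_apply x k = 0) \<longrightarrow> cinner k w = 0"
      by (auto simp: D_def)
    then show "v + w \<in> D"
      unfolding D_def by (auto intro!: exI[of _ "F \<union> G"] simp: cinner_add_right)
  next
    fix c w assume "w \<in> D"
    then show "c *\<^sub>C w \<in> D" by (force simp: D_def cinner_scaleC_right)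
  qed
  have PD: "P v \<in> closure D" for v
  proof (rule bipolar)
    show "csubspace (closure D)" using D by (rule csubspace_closure)
    fix r assume r: "\<And>z. z \<in> closure D \<Longrightarrow> cinner z r = 0"
    have "r \<in> K"
      unfolding K_def
    proof (intro CollectI ballI)
      fix x assume x: "x \<in> S"
      have "cinner k (adj x (x r)) = 0" if "x k = 0" for k
        using that by (simp add: cinner_adj_right SB x)
      then have "adj x (x r) \<in> D" using x unfolding D_def by (intro CollectI exI[of _ "{x}"]) auto
      then have "cinner (adj x (x r)) r = 0" using r closure_subset by blast
      then show "x r = 0" by (simp add: cinner_adj_left SB x cinner_self_eq_0_iff)
    qed
    then show "cinner r (P v) = 0" using E(5) by (simp add: P)
  qed simp

  have "P \<in> M"
  proof (rule strongly_closed_approximation[OF MS])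
    fix V :: "'a set" and e :: real assume V: "finite V" and e: "0 < e"
    have "\<forall>v. \<exists>w\<in>D. norm (P v - w) < e / 2"
      using PD e by (metis closure_approachable dist_commute dist_norm half_gt_zero)
    then obtain w where w: "\<And>v. w v \<in> D" "\<And>v. norm (P v - w v) < e / 2" by metis
    from w(1) have "\<forall>v. \<exists>F. finite F \<and> F \<subseteq> S \<and>
      (\<forall>k. (\<forall>x\<in>F. blinfun_apply x k = 0) \<longrightarrow> cinner k (w v) = 0)" by (simp add: D_def)
    then obtain G where G: "\<And>v. finite (G v)" "\<And>v. G v \<subseteq> S"
      "\<And>v k. (\<forall>x\<in>G v. blinfun_apply x k = 0) \<Longrightarrow> cinner k (w v) = 0"
      by metis
    define F where "F = (\<Union>v\<in>V. G v)"
    have F: "finite F" "F \<subseteq> S" using G V by (auto simp: F_def)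
    \<comment> \<open>the summand 1 keeps \<open>c\<close> positive when \<open>T F = 0\<close>\<close>
    define c where "c = 1 / (norm (T F) + 1)"
    have c: "0 < c" "c * norm (T F) \<le> 1"
      by (auto simp: c_def divide_simps add_nonneg_pos)
    have TB: "T F \<in> bounded_operators" using T_M[OF F(2)] MB by blast
    let ?B = "richardson (T F) c"
    have "eventually (\<lambda>n. norm ((?B ^^ n) (w v)) < e / 2) sequentially" if "v \<in> V" for v
    proof -
      have "(\<lambda>n. (?B ^^ n) (w v)) \<longlonglongrightarrow> 0"
      proof (rule richardson_tendsto_0[OF TB T_sa[OF F(2)] T_pos[OF F(2)] c])
        fix k assume "T F k = 0"
        then have "\<forall>x\<in>G v. blinfun_apply x k = 0" using T_ker[OF F] that by (auto simp: F_def)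
        then show "cinner k (w v) = 0" by (rule G(3))
      qed
      from order_tendstoD(2)[OF tendsto_norm_zero[OF this] half_gt_zero[OF e]] show ?thesis .
    qed
    with V have "eventually (\<lambda>n. \<forall>v\<in>V. norm ((?B ^^ n) (w v)) < e / 2) sequentially"
      by (simp add: eventually_ball_finite)
    then obtain n where n: "\<And>v. v \<in> V \<Longrightarrow> norm ((?B ^^ n) (w v)) < e / 2"
      by (auto simp: eventually_sequentially)
    obtain h where h: "h \<in> M" "\<And>v. v - blinfun_apply h v = (?B ^^ n) v"
      using richardson_iterate_in_algebra[OF M T_M[OF F(2)]] by blast
    have "norm (h v - P v) < e" if v: "v \<in> V" for v
    proof -
      have "T F (E v) = 0"
      proof -
        have "E v \<in> K" using E(3) by blast
        then show ?thesis using F(2) by (auto simp: T_def blinfun.sum_left K_def intro!: sum.neutral)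
      qed
      then have E_fixed: "(?B ^^ n) (E v) = E v" by (rule richardson_iterate_fixed)
      have "(?B ^^ n) v = (?B ^^ n) (E v) + (?B ^^ n) (P v - w v) + (?B ^^ n) (w v)"
        by (simp add: P flip: richardson_iterate_add)
      then have "P v - h v = (?B ^^ n) (P v - w v) + (?B ^^ n) (w v)"
        using h(2)[of v] E_fixed by (simp add: P algebra_simps)
      then have "norm (P v - h v) \<le> norm ((?B ^^ n) (P v - w v)) + norm ((?B ^^ n) (w v))"
        by (simp add: norm_triangle_ineq)
      also have "norm ((?B ^^ n) (P v - w v)) \<le> norm (P v - w v)"
        using richardson_iterate_contraction[OF TB T_sa[OF F(2)] _ _ T_pos[OF F(2)] _ c(2),
            of UNIV "P v - w v" n] c(1)
        by (simp add: csubspace_def)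
      also have "norm (P v - w v) + norm ((?B ^^ n) (w v)) < e / 2 + e / 2"
        using w(2) n[OF v] by (rule add_strict_mono)
      finally show ?thesis by (simp add: norm_minus_commute)
    qed
    then show "\<exists>y\<in>M. \<forall>v\<in>V. norm (y v - P v) < e" using h(1) by blast
  qed
  then show ?thesis
    using that[of P] Padj PP Pker by (auto simp: projections_def K_def)
qed

section \<open>The star order on bounded operators\<close>

text \<open>
  The symmetric form of the order: the first half of the definition is replaced by its adjoint,
  so that both conditions say that two operators agree on a range.
\<close>

lemma star_le_iff:
  fixes x y :: "'a::complex_hilbert_space \<Rightarrow>\<^sub>L 'a"
  assumes x: "x \<in> bounded_operators" and y: "y \<in> bounded_operators"
  shows "star_le x y \<longleftrightarrow>
    (\<forall>u. blinfun_apply y (adj x u) = x (adj x u)) \<and>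
    (\<forall>u. blinfun_apply (adj y) (x u) = adj x (x u))"
proof -
  note xy = x y adj_in_bounded_operators[OF x] adj_in_bounded_operators[OF y]
  have a: "adj (adj x o\<^sub>L x) = adj x o\<^sub>L x" "adj (adj x o\<^sub>L y) = adj y o\<^sub>L x"
    by (simp_all add: adj_compose adj_adj xy)
  have 1: "adj x o\<^sub>L x = adj x o\<^sub>L y \<longleftrightarrow> adj y o\<^sub>L x = adj x o\<^sub>L x"
    by (metis a adj_adj compose_in_bounded_operators xy)
  have ext: "f = g \<longleftrightarrow> (\<forall>u. blinfun_apply f u = blinfun_apply g u)" for f g :: "'a \<Rightarrow>\<^sub>L 'a"
    by (auto intro: blinfun_eqI)
  have "star_le x y \<longleftrightarrow> y o\<^sub>L adj x = x o\<^sub>L adj x \<and> adj y o\<^sub>L x = adj x o\<^sub>L x"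
    unfolding star_le_def 1 by auto
  then show ?thesis unfolding ext by simp
qed

text \<open>
  The range of \<open>xx*\<close> is dense in that of \<open>x\<close>; algebraically, \<open>axx* = 0\<close> gives
  \<open>(x*a*)*(x*a*) = 0\<close>, so \<open>x*a*\<close> vanishes and with it \<open>ax\<close>.
\<close>

lemma compose_adj_cancel:
  assumes a: "a \<in> bounded_operators" and x: "x \<in> bounded_operators"
    and 0: "\<And>u. blinfun_apply a (x (adj x u)) = 0"
  shows "blinfun_apply a (x u) = 0"
proof -
  have "cinner (a (x u)) (a (x u)) = cinner u (adj x (adj a (a (x u))))"
    by (simp add: cinner_adj_right a x)
  also have "adj x (adj a v) = 0" for v
  proof -
    have "cinner (adj x (adj a v)) (adj x (adj a v)) = cinner (a (x (adj x (adj a v)))) v"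
      by (simp add: cinner_adj_right a x)
    then show ?thesis by (simp add: 0 cinner_self_eq_0_iff)
  qed
  finally show ?thesis by (simp add: cinner_self_eq_0_iff)
qed

lemma star_le_refl: "star_le x x"
  by (simp add: star_le_def)

text \<open>
  If \<open>x \<preceq> y \<preceq> x\<close>, expanding \<open>(x - y)(x - y)*\<close> gives 0.
\<close>

lemma star_le_antisym:
  assumes x: "x \<in> bounded_operators" and y: "y \<in> bounded_operators"
    and "star_le x y" "star_le y x"
  shows "x = y"
proof -
  have "adj x u = adj y u" for u
  proof -
    have "(x - y) (adj x u - adj y u) = 0"
      using assms(3,4) by (simp add: star_le_iff x y blinfun.diff_left blinfun.diff_right)
    then have "cinner (adj x u - adj y u) (adj (x - y) u) = 0"
      by (simp add: cinner_adj_right diff_in_bounded_operators x y)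
    then have "cinner (adj x u - adj y u) (adj x u - adj y u) = 0"
      by (simp add: adj_diff x y blinfun.diff_left)
    then show ?thesis by (simp add: cinner_self_eq_0_iff)
  qed
  then have "adj x = adj y" by (rule blinfun_eqI)
  then show ?thesis using adj_adj x y by metis
qed

text \<open>
  On the range of \<open>xx* = yx*\<close>, which is part of the range of \<open>y\<close>, the adjoint of \<open>z\<close> agrees with
  that of \<open>y\<close>.  By cancellation this extends to the range of \<open>x\<close>.  The other half is the same
  argument for the adjoints.
\<close>

lemma star_le_trans:
  assumes x: "x \<in> bounded_operators" and y: "y \<in> bounded_operators" and z: "z \<in> bounded_operators"
    and "star_le x y" "star_le y z"
  shows "star_le x z"
proof -
  note * = assms(4)[unfolded star_le_iff[OF x y]] assms(5)[unfolded star_le_iff[OF y z]]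
  have "(adj z - adj y) (x u) = 0" for u
  proof (rule compose_adj_cancel[OF _ x])
    show "(adj z - adj y) (x (adj x u)) = 0" for u
      using * by (simp add: blinfun.diff_left flip: *(1)[THEN conjunct1, rule_format])
  qed (intro diff_in_bounded_operators adj_in_bounded_operators y z)
  moreover have "(z - y) (adj x u) = 0" for u
  proof (rule compose_adj_cancel[OF _ adj_in_bounded_operators[OF x]])
    show "(z - y) (adj x (adj (adj x) u)) = 0" for u
      using * by (simp add: adj_adj x blinfun.diff_left flip: *(1)[THEN conjunct2, rule_format])
  qed (intro diff_in_bounded_operators y z)
  ultimately show ?thesis using * by (simp add: star_le_iff x z blinfun.diff_left)
qed

lemma star_le_adj:
  assumes "x \<in> bounded_operators" "y \<in> bounded_operators" "star_le x y"
  shows "star_le (adj x) (adj y)"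
  using assms by (simp add: star_le_iff adj_in_bounded_operators adj_adj)

lemma partial_order_star_poset:
  assumes "M \<subseteq> bounded_operators"
  shows "partial_order (star_poset M)"
  using assms
  by unfold_locales
    (auto simp: star_poset_def subset_iff intro: star_le_refl star_le_antisym elim: star_le_trans[rotated 3])

lemma is_lub_star_poset_iff:
  assumes "S \<subseteq> M"
  shows "is_lub (star_poset M) s S \<longleftrightarrow>
    s \<in> M \<and> (\<forall>x\<in>S. star_le x s) \<and> (\<forall>y\<in>M. (\<forall>x\<in>S. star_le x y) \<longrightarrow> star_le s y)"
proof -
  have "x \<in> S \<and> x \<in> M \<longleftrightarrow> x \<in> S" for x using assms by blast
  then show ?thesis by (auto simp: least_def Upper_def star_poset_def)
qed

lemma is_glb_star_poset_iff:
  assumes "S \<subseteq> M"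
  shows "is_glb (star_poset M) s S \<longleftrightarrow>
    s \<in> M \<and> (\<forall>x\<in>S. star_le s x) \<and> (\<forall>y\<in>M. (\<forall>x\<in>S. star_le y x) \<longrightarrow> star_le y s)"
proof -
  have "x \<in> S \<and> x \<in> M \<longleftrightarrow> x \<in> S" for x using assms by blast
  then show ?thesis by (auto simp: greatest_def Lower_def star_poset_def)
qed

section \<open>Suprema and infima\<close>

text \<open>
  The range of \<open>P\<close> is the closed span of the ranges of the \<open>x*\<close> with
  \<open>x \<in> S\<close>, which is used through the step \<open>extend\<close>: operators that agree on those ranges agree
  after composition with \<open>P\<close>.  Any upper bound \<open>y\<close> equals \<open>x\<close>, hence \<open>b\<close>, on the range of
  \<open>x*\<close>, so that \<open>yP = bP\<close>.
\<close>

lemma is_lub_compose_support: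
  assumes M: "cstar_subalgebra M" and S: "S \<subseteq> M"
    and b: "b \<in> M" "\<And>x. x \<in> S \<Longrightarrow> star_le x b"
    and P: "P \<in> projections M" "\<And>k. blinfun_apply P k = 0 \<longleftrightarrow> (\<forall>x\<in>S. blinfun_apply x k = 0)"
  shows "is_lub (star_poset M) (b o\<^sub>L P) S"
proof -
  note MB = cstar_subalgebraD(1)[OF M]
  have SB: "x \<in> bounded_operators" if "x \<in> S" for x using that S MB by blast
  have bB: "b \<in> bounded_operators" using b MB by blast
  have P': "P \<in> M" "adj P = P" "P (P v) = P v" for v
    using P(1) blinfun_apply_blinfun_compose[of P P v] by (auto simp: projections_def)
  then have PB: "P \<in> bounded_operators" using MB by blast
  note Psym = cinner_adj_right[OF PB, unfolded P'(2)]
  have sM: "b o\<^sub>L P \<in> M" using b P' by (intro cstar_subalgebraD(5)[OF M])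
  then have sB: "b o\<^sub>L P \<in> bounded_operators" using MB by blast
  have s_adj: "adj (b o\<^sub>L P) u = P (adj b u)" for u
    by (simp add: adj_compose bB PB P'(2))
  have xP: "x (P v) = x v" if "x \<in> S" for x v
  proof -
    have "P (v - P v) = 0" by (simp add: blinfun.diff_right P'(3))
    then have "x (v - P v) = 0" using P(2) that by blast
    then show ?thesis by (simp add: blinfun.diff_right)
  qed
  have Px: "P (adj x u) = adj x u" if "x \<in> S" for x u
    by (rule cinner_ext_right) (simp add: Psym cinner_adj_right SB that xP)
  have extend: "a (P u) = a' (P u)"
    if aB: "a \<in> bounded_operators" "a' \<in> bounded_operators"
      and a: "\<And>x u. x \<in> S \<Longrightarrow> blinfun_apply a (adj x u) = blinfun_apply a' (adj x u)" for a a' u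
  proof -
    have dB: "a - a' \<in> bounded_operators" using aB by (rule diff_in_bounded_operators)
    have "P (adj (a - a') v) = 0" for v
    proof -
      have "x (adj (a - a') v) = 0" if x: "x \<in> S" for x
      proof (rule cinner_ext_right)
        show "cinner w (x (adj (a - a') v)) = cinner w 0" for w
          by (simp add: cinner_adj_left[OF SB[OF x], symmetric] cinner_adj_right[OF dB] a[OF x]
              blinfun.diff_left)
      qed
      then show ?thesis using P(2) by blast
    qed
    then have "cinner ((a - a') (P u)) v = 0" for v
      by (simp add: cinner_adj_right[OF dB, symmetric] Psym[symmetric])
    from this[of "(a - a') (P u)"] show ?thesis by (simp add: cinner_self_eq_0_iff blinfun.diff_left)
  qed
  have "star_le x (b o\<^sub>L P)" if x: "x \<in> S" for x
    using b(2)[OF x] SB[OF x] bB sB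
    by (simp add: star_le_iff s_adj Px[OF x])
  moreover have "star_le (b o\<^sub>L P) y" if y: "y \<in> M" "\<forall>x\<in>S. star_le x y" for y
  proof -
    have yB: "y \<in> bounded_operators" using y MB by blast
    have le: "b (adj x u) = x (adj x u)" "adj b (x u) = adj x (x u)"
      "y (adj x u) = x (adj x u)" "adj y (x u) = adj x (x u)" if "x \<in> S" for x u
      using b(2)[OF that] y(2) that SB[OF that] bB yB by (auto simp: star_le_iff)
    have "y (P v) = b (P v)" for v
      by (rule extend[OF yB bB]) (simp add: le)
    moreover have "adj y (b (P v)) = P (adj b (b (P v)))" for v
      using extend[of "adj y o\<^sub>L b" "P o\<^sub>L (adj b o\<^sub>L b)" v] yB bB PB
      by (simp add: compose_in_bounded_operators adj_in_bounded_operators le Px)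
    ultimately show ?thesis by (simp add: star_le_iff sB yB s_adj P'(3))
  qed
  ultimately show ?thesis using sM by (simp add: is_lub_star_poset_iff[OF S])
qed

lemma star_poset_lub_exists:
  assumes vN: "von_neumann_algebra M" and S: "S \<subseteq> M" and bdd: "Upper (star_poset M) S \<noteq> {}"
  shows "\<exists>s. is_lub (star_poset M) s S"
proof -
  obtain b where "b \<in> M" "\<And>x. x \<in> S \<Longrightarrow> star_le x b"
    using bdd S by (auto simp: Upper_def star_poset_def)
  moreover obtain P where "P \<in> projections M"
    "\<And>k. blinfun_apply P k = 0 \<longleftrightarrow> (\<forall>x\<in>S. blinfun_apply x k = 0)"
    using support_projection_exists[OF vN S] by blast
  ultimately show ?thesis
    using is_lub_compose_support[OF _ S] vN von_neumann_algebra_def by blast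
qed

text \<open>
  The supremum of the set of lower bounds is the infimum; a member of \<open>S\<close> bounds the lower
  bounds from above.
\<close>

lemma star_poset_glb_exists:
  assumes vN: "von_neumann_algebra M" and S: "S \<subseteq> M" "S \<noteq> {}"
  shows "\<exists>s. is_glb (star_poset M) s S"
proof -
  define L where "L = {y\<in>M. \<forall>x\<in>S. star_le y x}"
  have L: "L \<subseteq> M" by (auto simp: L_def)
  obtain x where "x \<in> S" using S(2) by blast
  then have "x \<in> Upper (star_poset M) L" using S(1) by (auto simp: Upper_def star_poset_def L_def)
  then obtain s where "is_lub (star_poset M) s L" using star_poset_lub_exists[OF vN L] by blast
  then have "s \<in> M" "\<forall>y\<in>L. star_le y s" "\<forall>y\<in>M. (\<forall>x\<in>L. star_le x y) \<longrightarrow> star_le s y"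
    unfolding is_lub_star_poset_iff[OF L] by blast+
  then have "is_glb (star_poset M) s S"
    unfolding is_glb_star_poset_iff[OF S(1)] using S(1) by (auto simp: L_def)
  then show ?thesis ..
qed

section \<open>Projections and self-adjoint elements\<close>

text \<open>
  From \<open>pxx* = ppx* = px* = xx*\<close> and cancellation, \<open>px = x\<close>.  As \<open>px = x*x\<close> by the order
  relation, \<open>x = x*x\<close> is self-adjoint, and then idempotent.
\<close>

lemma star_le_projection_imp_projection:
  assumes x: "x \<in> bounded_operators" and p: "p \<in> bounded_operators" "adj p = p" "p o\<^sub>L p = p"
    and le: "star_le x p"
  shows "adj x = x \<and> x o\<^sub>L x = x"
proof -
  have pp: "p (p v) = p v" for v using p(3) by (metis blinfun_apply_blinfun_compose)
  have le': "p (adj x u) = x (adj x u)" "p (x u) = adj x (x u)" for u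
    using le p(2) by (simp_all add: star_le_iff x p(1))
  have "(p - id_blinfun) (x u) = 0" for u
  proof (rule compose_adj_cancel[OF _ x])
    show "p - id_blinfun \<in> bounded_operators"
      by (intro diff_in_bounded_operators p) (simp add: bounded_operators_def)
    show "(p - id_blinfun) (x (adj x u)) = 0" for u
      by (simp add: blinfun.diff_left pp flip: le'(1))
  qed
  then have px: "p (x u) = x u" for u by (simp add: blinfun.diff_left)
  then have "x = adj x o\<^sub>L x" using le'(2) by (intro blinfun_eqI) simp
  moreover have "adj (adj x o\<^sub>L x) = adj x o\<^sub>L x"
    by (simp add: adj_compose adj_in_bounded_operators x adj_adj)
  ultimately show ?thesis by metis
qed

text \<open>
  The support projection \<open>P\<close> of \<open>S\<close> is itself an upper bound, so the general form \<open>bP\<close> of the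
  supremum applies with \<open>b = P\<close>.
\<close>

lemma projections_lub_exists:
  assumes vN: "von_neumann_algebra M" and S: "S \<subseteq> projections M"
  shows "\<exists>P\<in>projections M. is_lub (star_poset M) P S"
proof -
  have M: "cstar_subalgebra M" using vN by (simp add: von_neumann_algebra_def)
  note MB = cstar_subalgebraD(1)[OF M]
  have SM: "S \<subseteq> M" using S by (auto simp: projections_def)
  obtain P where P: "P \<in> projections M"
    "\<And>k. blinfun_apply P k = 0 \<longleftrightarrow> (\<forall>x\<in>S. blinfun_apply x k = 0)"
    using support_projection_exists[OF vN SM] by blast
  then have P': "P \<in> M" "adj P = P" "P o\<^sub>L P = P" by (auto simp: projections_def)
  have "star_le p P" if p: "p \<in> S" for p
  proof -
    have p': "adj p = p" "p o\<^sub>L p = p" "p \<in> bounded_operators"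
      using p S MB by (auto simp: projections_def)
    have pP: "p o\<^sub>L P = p"
    proof (rule blinfun_eqI)
      fix v
      have "P (v - P v) = 0" using P'(3) by (metis blinfun.diff_right blinfun_apply_blinfun_compose diff_self)
      then have "p (v - P v) = 0" using P(2) p by blast
      then show "(p o\<^sub>L P) v = p v" by (simp add: blinfun.diff_right)
    qed
    then have "adj (p o\<^sub>L P) = adj p" by simp
    then have "P o\<^sub>L p = p" using p' P' MB by (simp add: adj_compose subset_iff)
    with pP show ?thesis by (simp add: star_le_def p')
  qed
  from is_lub_compose_support[OF M SM P'(1) this P] show ?thesis
    using P(1) P'(3) by auto
qed

text \<open>
  Taking adjoints preserves and reflects the order and fixes \<open>S\<close> pointwise, so it maps the
  supremum of \<open>S\<close> to a supremum of \<open>S\<close>.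
\<close>

lemma is_lub_self_adjoint:
  assumes M: "cstar_subalgebra M" and S: "S \<subseteq> self_adjoints M" and s: "is_lub (star_poset M) s S"
  shows "adj s = s"
proof -
  have SM: "S \<subseteq> M" using S by (auto simp: self_adjoints_def)
  have adjS: "adj x = x" if "x \<in> S" for x using S that by (auto simp: self_adjoints_def)
  note MB = cstar_subalgebraD(1)[OF M] and adjM = cstar_subalgebraD(6)[OF M]
  have B: "x \<in> bounded_operators" if "x \<in> M" for x using that MB by blast
  note s' = s[unfolded is_lub_star_poset_iff[OF SM]]
  have "is_lub (star_poset M) (adj s) S"
    unfolding is_lub_star_poset_iff[OF SM]
  proof (intro conjI ballI impI)
    show "adj s \<in> M" using s' adjM by blast
    show "star_le x (adj s)" if "x \<in> S" for x
      using star_le_adj[of x s] s' that SM adjS[OF that] B by auto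
    show "star_le (adj s) y" if y: "y \<in> M" "\<forall>x\<in>S. star_le x y" for y
    proof -
      have "star_le x (adj y)" if "x \<in> S" for x
        using star_le_adj[of x y] y that SM adjS[OF that] B by auto
      then have "star_le s (adj y)" using s' adjM y(1) by blast
      then have "star_le (adj s) (adj (adj y))" using s' adjM y(1) B by (intro star_le_adj) auto
      then show ?thesis by (simp add: adj_adj B y(1))
    qed
  qed
  then show ?thesis using partial_order.least_unique[OF partial_order_star_poset[OF MB]] s by blast
qed

lemma is_glb_self_adjoint:
  assumes M: "cstar_subalgebra M" and S: "S \<subseteq> self_adjoints M" and s: "is_glb (star_poset M) s S"
  shows "adj s = s"
proof -
  have SM: "S \<subseteq> M" using S by (auto simp: self_adjoints_def)
  have adjS: "adj x = x" if "x \<in> S" for x using S that by (auto simp: self_adjoints_def)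
  note MB = cstar_subalgebraD(1)[OF M] and adjM = cstar_subalgebraD(6)[OF M]
  have B: "x \<in> bounded_operators" if "x \<in> M" for x using that MB by blast
  note s' = s[unfolded is_glb_star_poset_iff[OF SM]]
  have "is_glb (star_poset M) (adj s) S"
    unfolding is_glb_star_poset_iff[OF SM]
  proof (intro conjI ballI impI)
    show "adj s \<in> M" using s' adjM by blast
    show "star_le (adj s) x" if "x \<in> S" for x
      using star_le_adj[of s x] s' that SM adjS[OF that] B by auto
    show "star_le y (adj s)" if y: "y \<in> M" "\<forall>x\<in>S. star_le y x" for y
    proof -
      have "star_le (adj y) x" if "x \<in> S" for x
        using star_le_adj[of y x] y that SM adjS[OF that] B by auto
      then have "star_le (adj y) s" using s' adjM y(1) by blast
      then have "star_le (adj (adj y)) (adj s)" using s' adjM y(1) B by (intro star_le_adj) auto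
      then show ?thesis by (simp add: adj_adj B y(1))
    qed
  qed
  then show ?thesis using partial_order.greatest_unique[OF partial_order_star_poset[OF MB]] s by blast
qed

section \<open>Positive elements\<close>

text \<open>
  Polarisation: the sesquilinear form \<open>\<langle>v, x w\<rangle> - \<langle>x v, w\<rangle>\<close> vanishes on the diagonal, hence
  everywhere.  Positive elements are defined by their quadratic form alone, so this is what
  makes the results on self-adjoint elements available for them.
\<close>

lemma nonneg_form_imp_self_adjoint:
  assumes x: "x \<in> bounded_operators" and pos: "\<And>v. cinner v (blinfun_apply x v) \<in> \<real>\<^sub>\<ge>\<^sub>0"
  shows "adj x = x"
proof (rule adj_eqI)
  fix v w
  define a where "a p q = cinner p (x q) - cinner (x p) q" for p q
  have diag: "a p p = 0" for p
  proof -
    have "cinner (x p) p = cnj (cinner p (x p))" by (rule cinner_commute)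
    also have "\<dots> = cinner p (x p)"
      using pos[of p] by (simp add: complex_eq_iff complex_nonneg_Reals_iff)
    finally show ?thesis by (simp add: a_def)
  qed
  have "a v w + a w v = 0"
    using diag[of "v + w"] diag[of v] diag[of w]
    by (simp add: a_def blinfun.add_right cinner_add_left cinner_add_right algebra_simps)
  moreover have "\<i> * a v w - \<i> * a w v = 0"
    using diag[of "v + \<i> *\<^sub>C w"] diag[of v] diag[of w]
    by (simp add: a_def blinfun.add_right bounded_operatorsD[OF x] cinner_add_left cinner_add_right
        cinner_scaleC_left cinner_scaleC_right algebra_simps)
  then have "a v w = a w v" by simp
  ultimately have "2 * a v w = 0" by (metis mult_2)
  then have "a v w = 0" by simp
  then show "cinner (x v) w = cinner v (x w)" by (simp add: a_def)
qed

lemma cinner_self_adjoint_nonneg_Reals: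
  assumes x: "x \<in> bounded_operators" "adj x = x" and pos: "0 \<le> Re (cinner v (blinfun_apply x v))"
  shows "cinner v (blinfun_apply x v) \<in> \<real>\<^sub>\<ge>\<^sub>0"
proof -
  have "cinner v (x v) = cnj (cinner v (x v))"
    using cinner_adj_right[OF x(1), of v v] x(2) cinner_commute[of v "x v"] by simp
  from arg_cong[OF this, of Im] have "Im (cinner v (x v)) = 0" by simp
  with pos show ?thesis by (simp add: complex_nonneg_Reals_iff)
qed

text \<open>
  By log-convexity successive quotients of \<open>g\<close> increase; if the first one exceeded 1, then \<open>g\<close>
  would grow at least geometrically.
\<close>

lemma bounded_log_convex_decreases:
  fixes g :: "nat \<Rightarrow> real"
  assumes nonneg: "\<And>n. 0 \<le> g n" and convex: "\<And>n. (g (Suc n))\<^sup>2 \<le> g n * g (Suc (Suc n))"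
    and bdd: "\<And>n. g n \<le> C"
  shows "g 1 \<le> g 0"
proof (rule ccontr)
  assume "\<not> g 1 \<le> g 0"
  then have less: "g 0 < g 1" by simp
  have g0: "0 < g 0"
  proof (rule ccontr)
    assume "\<not> 0 < g 0"
    then have "g 0 = 0" using nonneg[of 0] by simp
    then have "(g 1)\<^sup>2 \<le> 0" using convex[of 0] by simp
    then show False using less \<open>g 0 = 0\<close> by simp
  qed
  define r where "r = g 1 / g 0"
  have r: "1 < r" using less g0 by (simp add: r_def)
  have step: "0 < g n \<and> r * g n \<le> g (Suc n)" for n
  proof (induction n)
    case 0
    show ?case using g0 by (simp add: r_def)
  next
    case (Suc n)
    have pos: "0 < g (Suc n)" using Suc r mult_pos_pos[of r "g n"] by linarith
    have "g n * (r * g (Suc n)) = (r * g n) * g (Suc n)" by simp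
    also have "\<dots> \<le> g (Suc n) * g (Suc n)" using Suc pos by (intro mult_right_mono) auto
    also have "\<dots> \<le> g n * g (Suc (Suc n))" using convex[of n] by (simp add: power2_eq_square)
    finally show ?case using Suc pos by simp
  qed
  have power: "r ^ n * g 0 \<le> g n" for n
  proof (induction n)
    case (Suc n)
    have "r ^ Suc n * g 0 = r * (r ^ n * g 0)" by simp
    also have "\<dots> \<le> r * g n" using Suc r by (intro mult_left_mono) auto
    finally show ?case using step[of n] by linarith
  qed simp
  obtain n where "C / g 0 < r ^ n" using real_arch_pow[OF r] by blast
  then have "C < r ^ n * g 0" using g0 by (simp add: divide_less_eq)
  then show False using power[of n] bdd[of n] by linarith
qed

text \<open>
  A negative spectral part of \<open>s\<close> in \<open>w\<close> would make the orbit under \<open>1 - cs\<close> grow.  Without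
  spectral theory: with \<open>B = 1 - cs\<close> self-adjoint, Cauchy-Schwarz for
  \<open>\<langle>B^n w, B^(n+2) w\<rangle> = |B^(n+1) w|^2\<close> shows that the norms \<open>|B^n w|\<close> are log-convex, so
  boundedness gives \<open>|Bw| \<le> |w|\<close>, which is the claim after expanding the square.
\<close>

lemma bounded_richardson_orbit_imp_nonneg:
  fixes s :: "'a::complex_hilbert_space \<Rightarrow>\<^sub>L 'a"
  assumes s: "s \<in> bounded_operators" "adj s = s" and c: "0 < c"
    and bdd: "\<And>n. norm ((richardson s c ^^ n) w) \<le> C"
  shows "0 \<le> Re (cinner w (blinfun_apply s w))"
proof -
  let ?B = "richardson s c"
  have sym: "cinner (?B u) v = cinner u (?B v)" for u v
    using cinner_adj_right[OF s(1), of u v] s(2)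
    by (simp add: richardson_def cinner_diff_left cinner_diff_right cinner_scaleR_left cinner_scaleR_right)
  have "(norm ((?B ^^ Suc n) w))\<^sup>2 \<le> norm ((?B ^^ n) w) * norm ((?B ^^ Suc (Suc n)) w)" for n
  proof -
    have "(norm ((?B ^^ Suc n) w))\<^sup>2 = Re (cinner ((?B ^^ n) w) ((?B ^^ Suc (Suc n)) w))"
      by (simp add: Re_cinner_self[symmetric] sym)
    also have "\<dots> \<le> norm ((?B ^^ n) w) * norm ((?B ^^ Suc (Suc n)) w)"
      using complex_Re_le_cmod cinner_Cauchy_Schwarz by (rule order_trans)
    finally show ?thesis .
  qed
  then have "norm ((?B ^^ 1) w) \<le> norm ((?B ^^ 0) w)"
    using bdd by (intro bounded_log_convex_decreases[where g = "\<lambda>n. norm ((?B ^^ n) w)"]) auto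
  then have "(norm (?B w))\<^sup>2 \<le> (norm w)\<^sup>2" by (simp add: power_mono)
  moreover have "(norm (?B w))\<^sup>2 = (norm w)\<^sup>2 - 2 * (c * Re (cinner w (s w))) + (norm (c *\<^sub>R s w))\<^sup>2"
    unfolding richardson_def norm_diff_squared by (simp add: cinner_scaleR_right)
  ultimately have "0 \<le> c * Re (cinner w (s w))"
    using zero_le_power2[of "norm (c *\<^sub>R s w)"] by argo
  then show ?thesis using c by (simp add: zero_le_mult_iff)
qed

text \<open>
  Split \<open>v\<close> along the closure of \<open>U\<close>: the orthogonal part is in the kernel of \<open>x\<close> and does not
  contribute, and on the closure the inequality holds by continuity.
\<close>

lemma nonneg_if_nonneg_on_subspace:
  fixes x :: "'a::complex_hilbert_space \<Rightarrow>\<^sub>L 'a"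
  assumes x: "x \<in> bounded_operators" "adj x = x" and U: "csubspace U"
    and pos: "\<And>w. w \<in> U \<Longrightarrow> 0 \<le> Re (cinner w (blinfun_apply x w))"
    and null: "\<And>k. (\<And>u. u \<in> U \<Longrightarrow> cinner u k = 0) \<Longrightarrow> blinfun_apply x k = 0"
  shows "0 \<le> Re (cinner v (blinfun_apply x v))"
proof -
  obtain w where w: "w \<in> closure U" "\<And>u. u \<in> closure U \<Longrightarrow> cinner u (v - w) = 0"
    using orthogonal_decomposition[OF csubspace_closure[OF U] closed_closure] by blast
  have "x (v - w) = 0" using w(2) closure_subset by (intro null) blast
  then have xv: "x v = x w" by (simp add: blinfun.diff_right)
  have "cinner v (x v) = cinner (x w) w"
    using cinner_adj_right[OF x(1), of v w] x(2) xv by simp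
  then have "Re (cinner v (x v)) = Re (cinner w (x w))" using Re_cinner_commute by metis
  moreover obtain f where f: "\<And>n. f n \<in> U" "f \<longlonglongrightarrow> w"
    using w(1) unfolding closure_sequential by blast
  have "(\<lambda>n. Re (cinner (f n) (x (f n)))) \<longlonglongrightarrow> Re (cinner w (x w))"
    by (intro tendsto_Re tendsto_cinner blinfun.tendsto tendsto_const f(2))
  then have "0 \<le> Re (cinner w (x w))"
    by (rule LIMSEQ_le_const) (use pos f(1) in auto)
  ultimately show ?thesis by simp
qed

lemma csubspace_range:
  assumes "x \<in> bounded_operators"
  shows "csubspace (range (blinfun_apply x))"
  unfolding csubspace_def
proof (intro conjI ballI allI)
  show "0 \<in> range x" by (metis blinfun.zero_right rangeI)
  show "u + v \<in> range x" if "u \<in> range x" "v \<in> range x" for u v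
    using that by (auto simp: blinfun.add_right[symmetric])
  show "c *\<^sub>C u \<in> range x" if "u \<in> range x" for c u
    using that by (auto simp: bounded_operatorsD[OF assms, symmetric])
qed

lemma perp_range_imp_null:
  assumes "x \<in> bounded_operators" "adj x = x" "\<And>u. cinner (blinfun_apply x u) k = 0"
  shows "blinfun_apply x k = 0"
proof (rule cinner_ext_right)
  show "cinner u (x k) = cinner u 0" for u
    using cinner_adj_right[OF assms(1), of u k] assms(2,3) by simp
qed

lemma positives_subset_self_adjoints:
  assumes "M \<subseteq> bounded_operators"
  shows "positives M \<subseteq> self_adjoints M"
  using assms by (auto simp: positives_def self_adjoints_def intro!: nonneg_form_imp_self_adjoint)

text \<open>
  The vectors with bounded orbit under \<open>1 - cs\<close> form a subspace \<open>U\<close> on which \<open>s\<close> is positive.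
  It contains the range of every \<open>x \<in> S\<close>, because \<open>s\<close> agrees with the positive \<open>x\<close> there.  What
  is orthogonal to \<open>U\<close> is in the common kernel of \<open>S\<close>, where \<open>s\<close> vanishes.
\<close>

lemma is_lub_positives:
  assumes vN: "von_neumann_algebra M" and S: "S \<subseteq> positives M" and lub: "is_lub (star_poset M) s S"
  shows "s \<in> positives M"
proof -
  have M: "cstar_subalgebra M" using vN by (simp add: von_neumann_algebra_def)
  note MB = cstar_subalgebraD(1)[OF M]
  have SM: "S \<subseteq> M" using S by (auto simp: positives_def)
  have Ssa: "S \<subseteq> self_adjoints M" using S positives_subset_self_adjoints[OF MB] by blast
  have sM: "s \<in> M" and le: "\<And>x. x \<in> S \<Longrightarrow> star_le x s"
    using lub by (auto simp: is_lub_star_poset_iff[OF SM])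
  have sB: "s \<in> bounded_operators" using sM MB by blast
  have sa: "adj s = s" using is_lub_self_adjoint[OF M Ssa lub] .
  obtain P where P: "P \<in> projections M"
    "\<And>k. blinfun_apply P k = 0 \<longleftrightarrow> (\<forall>x\<in>S. blinfun_apply x k = 0)"
    using support_projection_exists[OF vN SM] by blast
  \<comment> \<open>\<open>s\<close> is an upper bound of \<open>S\<close>, so its product with \<open>P\<close> is the supremum again\<close>
  have sP: "s o\<^sub>L P = s"
    using is_lub_compose_support[OF M SM sM le P] lub
      partial_order.least_unique[OF partial_order_star_poset[OF MB]] by blast
  define c where "c = 1 / (norm s + 1)"
  have c: "0 < c" "c * norm s \<le> 1" by (auto simp: c_def divide_simps add_nonneg_pos)
  let ?B = "richardson s c"
  define U where "U = {w. \<exists>C. \<forall>n. norm ((?B ^^ n) w) \<le> C}"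
  have U: "csubspace U"
    unfolding csubspace_def
  proof (intro conjI ballI allI)
    show "0 \<in> U" by (auto simp: U_def richardson_iterate_fixed)
  next
    fix v w assume "v \<in> U" "w \<in> U"
    then obtain C D where "\<forall>n. norm ((?B ^^ n) v) \<le> C" "\<forall>n. norm ((?B ^^ n) w) \<le> D"
      by (auto simp: U_def)
    then have "\<forall>n. norm ((?B ^^ n) (v + w)) \<le> C + D"
      by (auto simp: richardson_iterate_add intro: norm_triangle_le add_mono)
    then show "v + w \<in> U" by (auto simp: U_def)
  next
    fix a w assume "w \<in> U"
    then obtain C where "\<forall>n. norm ((?B ^^ n) w) \<le> C" by (auto simp: U_def)
    then have "\<forall>n. norm ((?B ^^ n) (a *\<^sub>C w)) \<le> cmod a * C"
      by (auto simp: richardson_iterate_scaleC[OF sB] norm_scaleC intro: mult_left_mono)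
    then show "a *\<^sub>C w \<in> U" by (auto simp: U_def)
  qed
  have SU: "blinfun_apply x u \<in> U" if x: "x \<in> S" for x u
  proof -
    have xB: "x \<in> bounded_operators" using x SM MB by blast
    have xsa: "adj x = x" using x Ssa by (auto simp: self_adjoints_def)
    have sx: "s (x v) = x (x v)" for v
      using le[OF x] by (simp add: star_le_iff xB sB xsa)
    have xpos: "0 \<le> Re (cinner v (x v))" for v
      using x S by (auto simp: positives_def complex_nonneg_Reals_iff)
    have "norm ((?B ^^ n) (x u)) \<le> norm (x u)" for n
      using richardson_iterate_contraction[OF sB sa csubspace_range[OF xB], where c = c] c
      by (force simp: sx xpos)
    then show ?thesis by (auto simp: U_def)
  qed
  have "0 \<le> Re (cinner v (s v))" for v
  proof (rule nonneg_if_nonneg_on_subspace[OF sB sa U])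
    show "0 \<le> Re (cinner w (s w))" if "w \<in> U" for w
      using that bounded_richardson_orbit_imp_nonneg[OF sB sa c(1)] by (auto simp: U_def)
    show "s k = 0" if k: "\<And>u. u \<in> U \<Longrightarrow> cinner u k = 0" for k
    proof -
      have "x k = 0" if "x \<in> S" for x
        using that SM MB Ssa k SU[OF that] by (intro perp_range_imp_null) (auto simp: self_adjoints_def)
      then have "P k = 0" using P(2) by blast
      then show ?thesis by (metis sP blinfun_apply_blinfun_compose blinfun.zero_right)
    qed
  qed
  then show ?thesis
    using sM cinner_self_adjoint_nonneg_Reals[OF sB sa] by (simp add: positives_def)
qed

text \<open>
  A single positive \<open>y \<in> S\<close> suffices: the self-adjoint \<open>s \<preceq> y\<close> agrees with \<open>y\<close> on its own range
  and vanishes on the orthogonal complement of that range.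
\<close>

lemma is_glb_positives:
  assumes M: "cstar_subalgebra M" and S: "S \<subseteq> positives M" "S \<noteq> {}" and glb: "is_glb (star_poset M) s S"
  shows "s \<in> positives M"
proof -
  note MB = cstar_subalgebraD(1)[OF M]
  have SM: "S \<subseteq> M" using S by (auto simp: positives_def)
  obtain y where y: "y \<in> S" using S(2) by blast
  have sM: "s \<in> M" and le: "star_le s y" using glb y by (auto simp: is_glb_star_poset_iff[OF SM])
  have sB: "s \<in> bounded_operators" using sM MB by blast
  have sa: "adj s = s"
    using is_glb_self_adjoint[OF M _ glb] S(1) positives_subset_self_adjoints[OF MB] by blast
  have ys: "y (s v) = s (s v)" for v
    using le y SM MB by (simp add: star_le_iff sB sa subset_iff)
  have "0 \<le> Re (cinner v (s v))" for v
  proof (rule nonneg_if_nonneg_on_subspace[OF sB sa csubspace_range[OF sB]])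
    have "0 \<le> Re (cinner (s u) (y (s u)))" for u
      using y S by (auto simp: positives_def complex_nonneg_Reals_iff)
    then show "0 \<le> Re (cinner w (s w))" if "w \<in> range s" for w
      using that by (auto simp: ys)
    show "s k = 0" if "\<And>u. u \<in> range s \<Longrightarrow> cinner u k = 0" for k
      using that by (intro perp_range_imp_null[OF sB sa]) auto
  qed
  then show ?thesis
    using sM cinner_self_adjoint_nonneg_Reals[OF sB sa] by (simp add: positives_def)
qed

theorem corollary3p3:
  fixes M :: "('a::complex_hilbert_space \<Rightarrow>\<^sub>L 'a) set"
  assumes "von_neumann_algebra M"
  shows "dedekind_complete (star_poset M) \<and>
    ((\<forall>S. S \<subseteq> projections M \<longrightarrow>
        sup_exists_in (star_poset M) S (projections M)) \<and>
     (\<forall>S. S \<subseteq> projections M \<and> S \<noteq> {} \<longrightarrow>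
        inf_exists_in (star_poset M) S (projections M))) \<and>
    ((\<forall>S. S \<subseteq> self_adjoints M \<and> order_bounded (star_poset M) S \<longrightarrow>
        sup_exists_in (star_poset M) S (self_adjoints M)) \<and>
     (\<forall>S. S \<subseteq> self_adjoints M \<and> S \<noteq> {} \<longrightarrow>
        inf_exists_in (star_poset M) S (self_adjoints M))) \<and>
    ((\<forall>S. S \<subseteq> positives M \<and> order_bounded (star_poset M) S \<longrightarrow>
        sup_exists_in (star_poset M) S (positives M)) \<and>
     (\<forall>S. S \<subseteq> positives M \<and> S \<noteq> {} \<longrightarrow>
        inf_exists_in (star_poset M) S (positives M)))"
proof -
  have M: "cstar_subalgebra M" using assms by (simp add: von_neumann_algebra_def)
  note MB = cstar_subalgebraD(1)[OF M]
  note lub_exists = star_poset_lub_exists[OF assms] and glb_exists = star_poset_glb_exists[OF assms]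
  note po = partial_order_star_poset[OF MB]
  have sub: "projections M \<subseteq> M" "self_adjoints M \<subseteq> M" "positives M \<subseteq> M"
    by (auto simp: projections_def self_adjoints_def positives_def)
  have "dedekind_complete (star_poset M)"
    unfolding dedekind_complete_def using po lub_exists by (auto simp: star_poset_def)
  moreover have "sup_exists_in (star_poset M) S (projections M)" if "S \<subseteq> projections M" for S
    unfolding sup_exists_in_def
    using projections_lub_exists[OF assms that] partial_order.least_unique[OF po] by metis
  moreover have "inf_exists_in (star_poset M) S (projections M)"
    if S: "S \<subseteq> projections M" "S \<noteq> {}" for S
  proof -
    have SM: "S \<subseteq> M" using S sub by blast
    have "s \<in> projections M" if "is_glb (star_poset M) s S" for s
    proof -
      obtain p where p: "p \<in> S" using S by blast
      have s: "s \<in> M" "star_le s p" using that p by (auto simp: is_glb_star_poset_iff[OF SM])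
      have "adj s = s \<and> s o\<^sub>L s = s"
        using s p S MB by (intro star_le_projection_imp_projection[of s p]) (auto simp: projections_def)
      with s show ?thesis by (simp add: projections_def)
    qed
    with glb_exists[OF SM S(2)] show ?thesis by (auto simp: inf_exists_in_def)
  qed
  moreover have "sup_exists_in (star_poset M) S (self_adjoints M)"
    if S: "S \<subseteq> self_adjoints M" "order_bounded (star_poset M) S" for S
  proof -
    have SM: "S \<subseteq> M" using S sub by blast
    show ?thesis
      unfolding sup_exists_in_def
      using lub_exists[OF SM] S is_lub_self_adjoint[OF M S(1)]
      by (auto simp: order_bounded_def self_adjoints_def is_lub_star_poset_iff[OF SM])
  qed
  moreover have "inf_exists_in (star_poset M) S (self_adjoints M)"
    if S: "S \<subseteq> self_adjoints M" "S \<noteq> {}" for S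
  proof -
    have SM: "S \<subseteq> M" using S sub by blast
    show ?thesis
      unfolding inf_exists_in_def
      using glb_exists[OF SM S(2)] is_glb_self_adjoint[OF M S(1)]
      by (auto simp: self_adjoints_def is_glb_star_poset_iff[OF SM])
  qed
  moreover have "sup_exists_in (star_poset M) S (positives M)"
    if S: "S \<subseteq> positives M" "order_bounded (star_poset M) S" for S
  proof -
    have SM: "S \<subseteq> M" using S sub by blast
    show ?thesis
      unfolding sup_exists_in_def
      using lub_exists[OF SM] S is_lub_positives[OF assms S(1)] by (auto simp: order_bounded_def)
  qed
  moreover have "inf_exists_in (star_poset M) S (positives M)"
    if S: "S \<subseteq> positives M" "S \<noteq> {}" for S
  proof -
    have SM: "S \<subseteq> M" using S sub by blast
    show ?thesis
      unfolding inf_exists_in_def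
      using glb_exists[OF SM S(2)] is_glb_positives[OF M S] by blast
  qed
  ultimately show ?thesis by simp
qed

end
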